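(* Let $\mathbf{a}=(a_1,\dots,a_n,\dots)$ be any infinite sequence in $\mathbf{D}$ (repetitions allowed), and let $\{B_k\}_{k=1}^\infty$ be the orthonormal system such that for every $n$, $(B_1,\dots,B_n)$ is the Gram–Schmidt orthonormalization of the generalized reproducing kernels $(\tilde k_{a_1},\dots,\tilde k_{a_n})$. For $f\in\mathbb{A}^2(\mathbf{D})$ let $$h=f-\sum_{k=1}^\infty\langle f,B_k\rangle B_k .$$ Then $h\in I_{\mathbf{a}}$. Moreover, there is the orthogonal direct sum decomposition $$\mathbb{A}^2(\mathbf{D})=\overline{\mathrm{span}}\{B_k\}_{k=1}^\infty\oplus I_{\mathbf{a}}.$$
   Context: $\mathbf{D}$ is the open unit disc. $\mathbb{A}^2(\mathbf{D})$ is the Hilbert space of holomorphic functions $f$ on $\mathbf{D}$ with $\|f\|^2=\int_{\mathbf{D}}|f|^2\,dA<\infty$, $dA=dx\,dy/\pi$, with inner product $\langle f,g\rangle=\int_{\mathbf{D}}f\overline g\,dA$. Its reproducing kernel is $k_w(z)=\frac{1}{(1-\overline w z)^2}$. For a sequence $(a_1,a_2,\dots)$ in $\mathbf{D}$, $l(a_n)$ is the number of times the value $a_n$ occurs in $(a_1,\dots,a_n)$, and the generalized reproducing kernels are $\tilde k_{a_n}(z)=\left(\frac{d}{d\overline w}\right)^{l(a_n)-1}k_w(z)\big|_{w=a_n}$. $I_{\mathbf{a}}$ is the set of all $f\in\mathbb{A}^2(\mathbf{D})$ vanishing at the points of $\mathbf{a}$ counted with multiplicity: if $a$ occurs $l$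 times in $\mathbf{a}$ then $f(a)=f'(a)=\dots=f^{(l-1)}(a)=0$ (with all derivatives vanishing if $a$ occurs infinitely often). *)

theory Defs
  imports "HOL-Analysis.Analysis"
begin

abbreviation unit_disc :: "complex set"
  where "unit_disc \<equiv> ball 0 1"


section \<open>The Bergman space of the unit disc\<close>

text \<open>
  A function on the disc is represented by its extension by zero to the complex plane, so that
  distinct elements of the type are distinct functions on the disc.
\<close>

definition bergman_fun :: "(complex \<Rightarrow> complex) \<Rightarrow> bool"
  where "bergman_fun f \<longleftrightarrow>
    f holomorphic_on unit_disc \<and>
    set_integrable lborel unit_disc (\<lambda>z. (cmod (f z))\<^sup>2) \<and>
    (\<forall>z. z \<notin> unit_disc \<longrightarrow> f z = 0)"

typedef bergman = "{f. bergman_fun f}"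
  by (rule exI[of _ "\<lambda>_. 0"]) (simp add: bergman_fun_def set_integrable_def)

setup_lifting type_definition_bergman

lemma bergman_fun_measurable:
  assumes "bergman_fun f"
  shows "f \<in> borel_measurable borel"
proof -
  have "continuous_on unit_disc f"
    using assms by (simp add: bergman_fun_def holomorphic_on_imp_continuous_on)
  hence "(\<lambda>z. indicator unit_disc z *\<^sub>R f z) \<in> borel_measurable borel"
    by (intro borel_measurable_continuous_on_indicator) auto
  also have "(\<lambda>z. indicator unit_disc z *\<^sub>R f z) = f"
    using assms by (auto simp: bergman_fun_def indicator_def fun_eq_iff)
  finally show ?thesis .
qed

lemma set_integrable_unit_disc_iff:
  fixes h :: "complex \<Rightarrow> 'a :: {banach, second_countable_topology}"
  assumes "\<And>z. z \<notin> unit_disc \<Longrightarrow> h z = 0"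
  shows "set_integrable lborel unit_disc h \<longleftrightarrow> integrable lborel h"
    and "(LINT z:unit_disc|lborel. h z) = integral\<^sup>L lborel h"
proof -
  have "(\<lambda>z. indicator unit_disc z *\<^sub>R h z) = h"
    using assms by (force simp: indicator_def fun_eq_iff)
  thus "set_integrable lborel unit_disc h \<longleftrightarrow> integrable lborel h"
    and "(LINT z:unit_disc|lborel. h z) = integral\<^sup>L lborel h"
    by (simp_all add: set_integrable_def set_lebesgue_integral_def)
qed

lemma bergman_fun_sq_integrable:
  assumes "bergman_fun f"
  shows "integrable lborel (\<lambda>z. (cmod (f z))\<^sup>2)"
  using assms set_integrable_unit_disc_iff(1)[of "\<lambda>z. (cmod (f z))\<^sup>2"]
  by (auto simp: bergman_fun_def)

lemma bergman_funI:
  assumes "f holomorphic_on unit_disc" "\<And>z. z \<notin> unit_disc \<Longrightarrow> f z = 0"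
    and "integrable lborel (\<lambda>z. (cmod (f z))\<^sup>2)"
  shows "bergman_fun f"
  using assms set_integrable_unit_disc_iff(1)[of "\<lambda>z. (cmod (f z))\<^sup>2"]
  by (auto simp: bergman_fun_def)

lemma bergman_fun_mult_integrable:
  assumes "bergman_fun f" "bergman_fun g"
  shows "integrable lborel (\<lambda>z. f z * cnj (g z))"
proof (rule Bochner_Integration.integrable_bound)
  show "integrable lborel (\<lambda>z. (cmod (f z))\<^sup>2 + (cmod (g z))\<^sup>2)"
    by (intro Bochner_Integration.integrable_add bergman_fun_sq_integrable assms)
  have "(\<lambda>z. cnj (g z)) \<in> borel_measurable borel"
    by (rule measurable_compose[OF bergman_fun_measurable[OF assms(2)]])
      (intro borel_measurable_continuous_onI continuous_intros)
  thus "(\<lambda>z. f z * cnj (g z)) \<in> borel_measurable lborel"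
    using bergman_fun_measurable[OF assms(1)] by simp
  have "a * b \<le> a\<^sup>2 + b\<^sup>2" for a b :: real
    using sum_squares_bound[of a b] zero_le_power2[of a] zero_le_power2[of b]
    by linarith
  thus "AE z in lborel. norm (f z * cnj (g z)) \<le> norm ((cmod (f z))\<^sup>2 + (cmod (g z))\<^sup>2)"
    by (auto simp: norm_mult)
qed

lemma bergman_fun_add:
  assumes "bergman_fun f" "bergman_fun g"
  shows "bergman_fun (\<lambda>z. f z + g z)"
proof (rule bergman_funI)
  show "(\<lambda>z. f z + g z) holomorphic_on unit_disc"
    using assms by (auto simp: bergman_fun_def intro!: holomorphic_intros)
  show "integrable lborel (\<lambda>z. (cmod (f z + g z))\<^sup>2)"
  proof (rule Bochner_Integration.integrable_bound)
    show "integrable lborel (\<lambda>z. 2 * (cmod (f z))\<^sup>2 + 2 * (cmod (g z))\<^sup>2)"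
      by (intro Bochner_Integration.integrable_add integrable_mult_right
          bergman_fun_sq_integrable assms)
    show "(\<lambda>z. (cmod (f z + g z))\<^sup>2) \<in> borel_measurable lborel"
      using bergman_fun_measurable[OF assms(1)] bergman_fun_measurable[OF assms(2)] by simp
    have "(cmod (x + y))\<^sup>2 \<le> 2 * (cmod x)\<^sup>2 + 2 * (cmod y)\<^sup>2" for x y :: complex
    proof -
      have "(cmod (x + y))\<^sup>2 \<le> (cmod x + cmod y)\<^sup>2"
        by (intro power_mono norm_triangle_ineq) auto
      also have "\<dots> \<le> 2 * (cmod x)\<^sup>2 + 2 * (cmod y)\<^sup>2"
        using sum_squares_bound[of "cmod x" "cmod y"] by (simp add: power2_sum)
      finally show ?thesis .
    qed
    thus "AE z in lborel. norm ((cmod (f z + g z))\<^sup>2)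
        \<le> norm (2 * (cmod (f z))\<^sup>2 + 2 * (cmod (g z))\<^sup>2)"
      by auto
  qed
qed (use assms in \<open>auto simp: bergman_fun_def\<close>)

lemma bergman_fun_cmult:
  assumes "bergman_fun f"
  shows "bergman_fun (\<lambda>z. c * f z)"
proof (rule bergman_funI)
  show "(\<lambda>z. c * f z) holomorphic_on unit_disc"
    using assms by (auto simp: bergman_fun_def intro!: holomorphic_intros)
  show "integrable lborel (\<lambda>z. (cmod (c * f z))\<^sup>2)"
    unfolding norm_mult power_mult_distrib
    by (intro integrable_mult_right bergman_fun_sq_integrable assms)
qed (use assms in \<open>auto simp: bergman_fun_def\<close>)

lemma bergman_fun_eq_0:
  assumes "bergman_fun f" "(\<integral>z. (cmod (f z))\<^sup>2 \<partial>lborel) = 0"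
  shows "f z = 0"
proof -
  have "AE z in lborel. (cmod (f z))\<^sup>2 = 0"
    using assms(2) integral_nonneg_eq_0_iff_AE[OF bergman_fun_sq_integrable[OF assms(1)]] by simp
  hence ae: "AE z in lborel. f z = 0" by simp
  have meas: "{z. f z \<noteq> 0} \<in> sets lborel"
    using bergman_fun_measurable[OF assms(1)] by measurable
  have "{z. f z \<noteq> 0} \<in> null_sets lborel"
    using ae meas by (subst (asm) AE_iff_null) auto
  hence negl: "negligible {z. f z \<noteq> 0}"
    using negligible_iff_null_sets null_sets_completionI by blast
  have "{z. f z \<noteq> 0} = {z \<in> unit_disc. f z \<in> - {0}}"
    using assms(1) by (auto simp: bergman_fun_def)
  moreover have "open {z \<in> unit_disc. f z \<in> - {0}}"
  proof -
    have "continuous_on unit_disc f"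
      using assms(1) by (simp add: bergman_fun_def holomorphic_on_imp_continuous_on)
    hence "open (f -` (- {0}) \<inter> unit_disc)"
      by (rule continuous_on_open_vimage[THEN iffD1, rule_format, OF open_ball]) auto
    moreover have "f -` (- {0}) \<inter> unit_disc = {z \<in> unit_disc. f z \<in> - {0}}" by auto
    ultimately show ?thesis by simp
  qed
  ultimately have "{z. f z \<noteq> 0} = {}"
    using negl open_not_negligible by metis
  thus ?thesis by auto
qed


subsection \<open>Vector space structure\<close>

instantiation bergman :: real_vector
begin

lift_definition zero_bergman :: bergman is "\<lambda>_. 0"
  by (simp add: bergman_fun_def set_integrable_def)

lift_definition plus_bergman :: "bergman \<Rightarrow> bergman \<Rightarrow> bergman" is "\<lambda>f g z. f z + g z"
  by (rule bergman_fun_add)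

lift_definition uminus_bergman :: "bergman \<Rightarrow> bergman" is "\<lambda>f z. - f z"
  using bergman_fun_cmult[of _ "-1"] by simp

lift_definition minus_bergman :: "bergman \<Rightarrow> bergman \<Rightarrow> bergman" is "\<lambda>f g z. f z - g z"
  subgoal premises prems for f g
    using bergman_fun_add[OF prems(1) bergman_fun_cmult[OF prems(2), of "-1"]] by simp
  done

lift_definition scaleR_bergman :: "real \<Rightarrow> bergman \<Rightarrow> bergman" is "\<lambda>r f z. of_real r * f z"
  by (rule bergman_fun_cmult)

instance
  by standard (transfer; simp add: fun_eq_iff algebra_simps)+

end

lift_definition cscale :: "complex \<Rightarrow> bergman \<Rightarrow> bergman"  (infixr \<open>*\<^sub>C\<close> 75) is "\<lambda>c f z. c * f z"
  by (rule bergman_fun_cmult)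

interpretation bergman: vector_space cscale
  by standard (transfer; simp add: fun_eq_iff algebra_simps)+


subsection \<open>Inner product\<close>

text \<open>The area measure is normalised, $dA = dx\,dy/\pi$.\<close>

lift_definition cinner :: "bergman \<Rightarrow> bergman \<Rightarrow> complex" is
  "\<lambda>f g. (LINT z:unit_disc|lborel. f z * cnj (g z)) / of_real pi" .

text \<open>
  The norm is that of the complex inner product \<^const>\<open>cinner\<close>; the library's class of inner
  product spaces is real, and is instantiated with the real part of \<^const>\<open>cinner\<close>, which induces
  the same norm.
\<close>

instantiation bergman :: real_inner
begin

lift_definition norm_bergman :: "bergman \<Rightarrow> real" is
  "\<lambda>f. sqrt ((LINT z:unit_disc|lborel. (cmod (f z))\<^sup>2) / pi)" .

definition inner_bergman :: "bergman \<Rightarrow> bergman \<Rightarrow> real"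
  where "inner_bergman f g = Re (cinner f g)"

definition dist_bergman :: "bergman \<Rightarrow> bergman \<Rightarrow> real"
  where "dist_bergman f g = norm (f - g)"

definition sgn_bergman :: "bergman \<Rightarrow> bergman"
  where "sgn_bergman f = f /\<^sub>R norm f"

definition uniformity_bergman :: "(bergman \<times> bergman) filter"
  where "uniformity_bergman = (INF e\<in>{0 <..}. principal {(f, g). dist f g < e})"

definition open_bergman :: "bergman set \<Rightarrow> bool"
  where "open_bergman S = (\<forall>f\<in>S. \<forall>\<^sub>F (f', g) in uniformity. f' = f \<longrightarrow> g \<in> S)"

lemma cinner_lborel:
  "cinner f g = (\<integral>z. Rep_bergman f z * cnj (Rep_bergman g z) \<partial>lborel) / of_real pi"
proof -
  have "Rep_bergman f z = 0" if "z \<notin> unit_disc" for z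
    using that Rep_bergman[of f] by (auto simp: bergman_fun_def)
  hence "(LINT z:unit_disc|lborel. Rep_bergman f z * cnj (Rep_bergman g z)) =
      (\<integral>z. Rep_bergman f z * cnj (Rep_bergman g z) \<partial>lborel)"
    by (intro set_integrable_unit_disc_iff(2)) auto
  thus ?thesis by (simp only: cinner.rep_eq)
qed

lemma cinner_integrable: "integrable lborel (\<lambda>z. Rep_bergman f z * cnj (Rep_bergman g z))"
  using Rep_bergman by (auto intro!: bergman_fun_mult_integrable)

lemma cinner_self_eq:
  "cinner f f = of_real ((\<integral>z. (cmod (Rep_bergman f z))\<^sup>2 \<partial>lborel) / pi)"
  unfolding cinner_lborel complex_norm_square[symmetric] of_real_divide
    integral_complex_of_real ..

lemma norm_bergman_lborel:
  "norm f = sqrt ((\<integral>z. (cmod (Rep_bergman f z))\<^sup>2 \<partial>lborel) / pi)"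
proof -
  have "Rep_bergman f z = 0" if "z \<notin> unit_disc" for z
    using that Rep_bergman[of f] by (auto simp: bergman_fun_def)
  hence "(LINT z:unit_disc|lborel. (cmod (Rep_bergman f z))\<^sup>2) =
      (\<integral>z. (cmod (Rep_bergman f z))\<^sup>2 \<partial>lborel)"
    by (intro set_integrable_unit_disc_iff(2)) auto
  thus ?thesis by (simp only: norm_bergman.rep_eq)
qed

lemma cinner_commute: "cinner f g = cnj (cinner g f)"
proof -
  have "(\<integral>z. Rep_bergman f z * cnj (Rep_bergman g z) \<partial>lborel) =
      (\<integral>z. cnj (Rep_bergman g z * cnj (Rep_bergman f z)) \<partial>lborel)"
    by (simp only: complex_cnj_mult complex_cnj_cnj mult.commute)
  thus ?thesis
    by (simp only: cinner_lborel complex_cnj_divide Bochner_Integration.integral_cnj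
        complex_cnj_complex_of_real)
qed

lemma cinner_add_left: "cinner (f + g) h = cinner f h + cinner g h"
  by (simp only: cinner_lborel plus_bergman.rep_eq distrib_right add_divide_distrib
      Bochner_Integration.integral_add[OF cinner_integrable cinner_integrable])

lemma cinner_cscale_left: "cinner (c *\<^sub>C f) h = c * cinner f h"
  by (simp only: cinner_lborel cscale.rep_eq mult.assoc integral_mult_right_zero
      times_divide_eq_right)

lemma scaleR_eq_cscale: "r *\<^sub>R f = of_real r *\<^sub>C (f :: bergman)"
  by transfer simp

instance
proof
  fix f g h :: bergman and r :: real
  show "dist f g = norm (f - g)" by (simp add: dist_bergman_def)
  show "sgn f = f /\<^sub>R norm f" by (simp add: sgn_bergman_def)
  show "uniformity = (INF e\<in>{0 <..}. principal {(x :: bergman, y). dist x y < e})"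
    by (rule uniformity_bergman_def)
  show "open S = (\<forall>x\<in>S. \<forall>\<^sub>F (x', y) in uniformity. x' = x \<longrightarrow> y \<in> S)" for S :: "bergman set"
    by (rule open_bergman_def)
  show "inner f g = inner g f"
    unfolding inner_bergman_def by (subst cinner_commute) simp
  show "inner (f + g) h = inner f h + inner g h"
    by (simp add: inner_bergman_def cinner_add_left)
  show "inner (r *\<^sub>R f) g = r * inner f g"
    by (simp add: inner_bergman_def scaleR_eq_cscale cinner_cscale_left)
  show "0 \<le> inner f f"
    by (simp add: inner_bergman_def cinner_self_eq)
  show "inner f f = 0 \<longleftrightarrow> f = 0"
  proof
    assume "inner f f = 0"
    hence "(\<integral>z. (cmod (Rep_bergman f z))\<^sup>2 \<partial>lborel) = 0"
      by (simp add: inner_bergman_def cinner_self_eq)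
    hence "Rep_bergman f z = 0" for z
      by (rule bergman_fun_eq_0[OF Rep_bergman[of f, unfolded mem_Collect_eq]])
    hence "Rep_bergman f = Rep_bergman 0"
      by (simp add: zero_bergman.rep_eq fun_eq_iff)
    thus "f = 0" by (rule Rep_bergman_inject[THEN iffD1])
  qed (simp add: inner_bergman_def cinner_self_eq zero_bergman.rep_eq)
  show "norm f = sqrt (inner f f)"
    by (simp add: norm_bergman_lborel inner_bergman_def cinner_self_eq)
qed

end


section \<open>Generalised reproducing kernels\<close>

definition wirtinger_cnj :: "(complex \<Rightarrow> complex) \<Rightarrow> complex \<Rightarrow> complex"
  where "wirtinger_cnj g w =
    (vector_derivative (\<lambda>x. g (w + of_real x)) (at 0) +
      \<i> * vector_derivative (\<lambda>y. g (w + \<i> * of_real y)) (at 0)) / 2"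

definition bergman_kernel :: "complex \<Rightarrow> complex \<Rightarrow> complex"
  where "bergman_kernel w z = 1 / (1 - cnj w * z)\<^sup>2"

lemma wirtinger_cnj_antiholomorphic:
  assumes "open S" "w \<in> S" "\<And>u. u \<in> S \<Longrightarrow> g u = G (cnj u)"
    and G: "(G has_field_derivative G') (at (cnj w))"
  shows "wirtinger_cnj g w = G'"
proof -
  have line: "vector_derivative (\<lambda>x. g (w + c * of_real x)) (at 0) = cnj c * G'" for c
  proof (rule vector_derivative_at)
    have "((\<lambda>x. cnj w + cnj c * of_real x) has_vector_derivative cnj c) (at (0::real))"
      by (auto intro!: derivative_eq_intros)
    from field_vector_diff_chain_at[OF this, of G G'] G
    have *: "((\<lambda>x. G (cnj w + cnj c * of_real x)) has_vector_derivative cnj c * G') (at (0::real))"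
      by (simp add: o_def)
    have op: "open ((\<lambda>x::real. w + c * of_real x) -` S)"
      by (intro open_vimage assms continuous_intros)
    show "((\<lambda>x. g (w + c * of_real x)) has_vector_derivative cnj c * G') (at (0::real))"
      by (rule has_vector_derivative_transform_within_open[OF * op])
        (use assms in auto)
  qed
  have "\<i> * (cnj \<i> * G') = G'"
    unfolding mult.assoc[symmetric] by simp
  thus ?thesis
    using line[of 1] line[of \<i>] by (simp only: wirtinger_cnj_def mult_1 complex_cnj_one) simp
qed

lemma norm_one_minus_cnj_mult:
  assumes "w \<in> unit_disc" "z \<in> unit_disc"
  shows "cmod (1 - cnj w * z) \<ge> 1 - cmod w" "1 - cnj w * z \<noteq> 0"
proof -
  have "cmod (cnj w * z) \<le> cmod w * 1"
    using assms unfolding norm_mult by (intro mult_mono) auto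
  thus "cmod (1 - cnj w * z) \<ge> 1 - cmod w"
    using norm_triangle_ineq2[of 1 "cnj w * z"] by simp
  thus "1 - cnj w * z \<noteq> 0"
    using assms by auto
qed

lemma wirtinger_cnj_bergman_kernel:
  assumes "w \<in> unit_disc" "z \<in> unit_disc"
  shows "(wirtinger_cnj ^^ j) (\<lambda>u. bergman_kernel u z) w =
    fact (Suc j) * z ^ j / (1 - cnj w * z) ^ (j + 2)"
  using assms(1)
proof (induction j arbitrary: w)
  case 0
  thus ?case by (simp add: bergman_kernel_def power2_eq_square)
next
  case (Suc j)
  have nz: "1 - cnj w * z \<noteq> 0"
    using norm_one_minus_cnj_mult(2)[OF Suc.prems assms(2)] .
  have "((\<lambda>v. fact (Suc j) * z ^ j / (1 - v * z) ^ (j + 2)) has_field_derivative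
      fact (Suc (Suc j)) * z ^ Suc j / (1 - cnj w * z) ^ (Suc j + 2)) (at (cnj w))"
  proof -
    define t where "t = 1 - cnj w * z"
    have t: "t \<noteq> 0" using nz by (simp add: t_def)
    have "((\<lambda>v. 1 - v * z) has_field_derivative - z) (at (cnj w))"
      by (auto intro!: derivative_eq_intros)
    from DERIV_power[OF this, of "j + 2"]
    have P: "((\<lambda>v. (1 - v * z) ^ (j + 2)) has_field_derivative
        of_nat (j + 2) * (- z) * t ^ (j + 1)) (at (cnj w))"
      by (simp only: t_def mult.assoc diff_Suc_1' one_add_one[symmetric] add.assoc[symmetric]
          One_nat_def[symmetric] add_diff_cancel_right')
    have D: "((\<lambda>v. fact (Suc j) * z ^ j / (1 - v * z) ^ (j + 2)) has_field_derivative
        (0 * t ^ (j + 2) - fact (Suc j) * z ^ j * (of_nat (j + 2) * (- z) * t ^ (j + 1)))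
          / (t ^ (j + 2) * t ^ (j + 2))) (at (cnj w))"
      unfolding t_def
      by (rule DERIV_divide[OF DERIV_const P[unfolded t_def] power_not_zero[OF nz]])
    have E: "(0 * t ^ (j + 2) - fact (Suc j) * z ^ j * (of_nat (j + 2) * (- z) * t ^ (j + 1)))
          / (t ^ (j + 2) * t ^ (j + 2)) = fact (Suc (Suc j)) * z ^ Suc j / t ^ (Suc j + 2)"
    proof -
      have fs: "fact (Suc (Suc j)) = (of_nat (j + 2) * fact (Suc j) :: complex)"
        by (simp only: fact_Suc) simp
      have "t ^ (j + 2) * t ^ (j + 2) = t ^ (j + 1) * t ^ (Suc j + 2)"
        unfolding power_add[symmetric] by (rule arg_cong[of _ _ "\<lambda>m. t ^ m"]) simp
      moreover have "0 * t ^ (j + 2) - fact (Suc j) * z ^ j * (of_nat (j + 2) * (- z) * t ^ (j + 1)) =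
          t ^ (j + 1) * (fact (Suc (Suc j)) * z ^ Suc j)"
        unfolding fs power_Suc by (simp only: mult_ac mult_minus_left mult_minus_right
            mult_zero_left diff_0 minus_minus)
      moreover have "t ^ (j + 1) \<noteq> 0"
        using t by (rule power_not_zero)
      ultimately show ?thesis
        by (simp only: nonzero_mult_divide_mult_cancel_left simp_thms)
    qed
    show ?thesis using D unfolding E unfolding t_def .
  qed
  from wirtinger_cnj_antiholomorphic[OF open_ball Suc.prems Suc.IH this]
  show ?case by (simp only: funpow.simps o_apply)
qed

text \<open>
  The function $z \mapsto (d/d\overline{w})^j\, k_w(z)$ as an element of the Bergman space
  (zero if $w$ is not in the disc, a case that does not occur below).
\<close>

lift_definition kernel_deriv :: "nat \<Rightarrow> complex \<Rightarrow> bergman" is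
  "\<lambda>j w z. if w \<in> unit_disc \<and> z \<in> unit_disc
     then (wirtinger_cnj ^^ j) (\<lambda>u. bergman_kernel u z) w else 0"
proof -
  fix j :: nat and w :: complex
  let ?f = "\<lambda>z. if w \<in> unit_disc \<and> z \<in> unit_disc
     then (wirtinger_cnj ^^ j) (\<lambda>u. bergman_kernel u z) w else 0"
  let ?g = "\<lambda>z. fact (Suc j) * z ^ j / (1 - cnj w * z) ^ (j + 2)"
  show "bergman_fun ?f"
  proof (cases "w \<in> unit_disc")
    case True
    have hol: "?f holomorphic_on unit_disc"
    proof (subst holomorphic_cong[OF refl])
      show "?f z = ?g z" if "z \<in> unit_disc" for z
        using wirtinger_cnj_bergman_kernel[OF True that] True that by simp
      show "?g holomorphic_on unit_disc"
        by (intro holomorphic_intros) (use norm_one_minus_cnj_mult(2)[OF True] in auto)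
    qed
    define C where "C = fact (Suc j) / (1 - cmod w) ^ (j + 2)"
    have C: "cmod (?f z) \<le> C" if z: "z \<in> unit_disc" for z
    proof -
      have fg: "?f z = ?g z"
        using wirtinger_cnj_bergman_kernel[OF True z] True z by (simp only: if_True simp_thms)
      have "cmod (?f z) = fact (Suc j) * cmod z ^ j / cmod (1 - cnj w * z) ^ (j + 2)"
        unfolding fg norm_divide norm_mult norm_power norm_fact ..
      also have "\<dots> \<le> fact (Suc j) / (1 - cmod w) ^ (j + 2)"
      proof (rule frac_le)
        show "fact (Suc j) * cmod z ^ j \<le> fact (Suc j)"
          using z by (intro mult_left_le power_le_one fact_ge_zero) auto
        show "0 < (1 - cmod w) ^ (j + 2)"
          using True by (intro zero_less_power) auto
        show "(1 - cmod w) ^ (j + 2) \<le> cmod (1 - cnj w * z) ^ (j + 2)"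
          using True by (intro power_mono norm_one_minus_cnj_mult(1)[OF True z]) auto
      qed (rule fact_ge_zero)
      finally show ?thesis by (simp only: C_def)
    qed
    have meas: "?f \<in> borel_measurable borel"
    proof -
      have "(\<lambda>z. indicator unit_disc z *\<^sub>R ?f z) \<in> borel_measurable borel"
        by (intro borel_measurable_continuous_on_indicator holomorphic_on_imp_continuous_on hol) auto
      also have "(\<lambda>z. indicator unit_disc z *\<^sub>R ?f z) = ?f"
        by (auto simp: indicator_def fun_eq_iff)
      finally show ?thesis .
    qed
    have "integrable lborel (\<lambda>z. (cmod (?f z))\<^sup>2)"
    proof (rule Bochner_Integration.integrable_bound)
      show "integrable lborel (\<lambda>z. indicator unit_disc z *\<^sub>R C\<^sup>2)"
        by (intro integrable_scaleR_left integrable_real_indicator)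
          (use emeasure_lborel_ball_finite[of "0 :: complex" 1] in \<open>auto simp: top.not_eq_extremum\<close>)
      show "(\<lambda>z. (cmod (?f z))\<^sup>2) \<in> borel_measurable lborel"
        using borel_measurable_power[OF measurable_compose[OF meas borel_measurable_norm], of 2]
        by (simp only: measurable_lborel2)
      have "(cmod (?f z))\<^sup>2 \<le> indicator unit_disc z *\<^sub>R C\<^sup>2" for z
      proof (cases "z \<in> unit_disc")
        case True
        with power_mono[OF C[OF True] norm_ge_zero, of 2] show ?thesis
          by (simp only: indicator_simps scaleR_one)
      qed auto
      thus "AE z in lborel. norm ((cmod (?f z))\<^sup>2) \<le> norm (indicator unit_disc z *\<^sub>R C\<^sup>2)"
        by (intro always_eventually allI)
          (simp only: real_norm_def abs_power2, rule order_trans[OF _ abs_ge_self])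
    qed
    thus ?thesis by (intro bergman_funI hol) auto
  next
    case False
    hence "?f = (\<lambda>_. 0)" by (simp only: simp_thms if_False)
    thus ?thesis by (simp only:) (simp add: bergman_fun_def set_integrable_def)
  qed
qed

text \<open>
  Sequences are indexed from 0, so that the number of indices \<open>m < n\<close> with \<open>a m = a n\<close> is
  $l(a_n) - 1$.
\<close>

definition gen_kernel :: "(nat \<Rightarrow> complex) \<Rightarrow> nat \<Rightarrow> bergman"
  where "gen_kernel a n = kernel_deriv (card {m. m < n \<and> a m = a n}) (a n)"


section \<open>Gram--Schmidt orthonormalisation\<close>

text \<open>
  A vector in the span of its predecessors is sent to zero. This does not happen for the
  generalised kernels, which are linearly independent.
\<close>

fun gram_schmidt :: "(nat \<Rightarrow> bergman) \<Rightarrow> nat \<Rightarrow> bergman"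
  where "gram_schmidt v n =
    (let u = v n - (\<Sum>k<n. cinner (v n) (gram_schmidt v k) *\<^sub>C gram_schmidt v k)
     in u /\<^sub>R norm u)"

declare gram_schmidt.simps [simp del]


section \<open>The zero-based invariant subspace of a sequence\<close>

definition vanishing_space :: "(nat \<Rightarrow> complex) \<Rightarrow> bergman set"
  where "vanishing_space a =
    {f. \<forall>c j. infinite {n. a n = c} \<or> j < card {n. a n = c} \<longrightarrow>
          (deriv ^^ j) (Rep_bergman f) c = 0}"


section \<open>Orthogonal direct sums\<close>

definition orthogonal_direct_sum :: "bergman set \<Rightarrow> bergman set \<Rightarrow> bergman set \<Rightarrow> bool"
  where "orthogonal_direct_sum V S T \<longleftrightarrow>
    bergman.subspace S \<and> bergman.subspace T \<and>
    (\<forall>f\<in>S. \<forall>g\<in>T. cinner f g = 0) \<and>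
    S \<inter> T = {0} \<and>
    V = {f + g | f g. f \<in> S \<and> g \<in> T}"

end

theory Submission
  imports Defs "HOL-Complex_Analysis.Complex_Analysis"
begin

text \<open>
  Rotation invariance of area makes the monomials orthogonal on every disc around 0, so integrating
  the Taylor series of \<open>f\<close> over discs of radius \<open>r < 1\<close> and letting \<open>r\<close> tend to 1 gives
  the inner product \<open>a\<^sub>n / (n + 1)\<close> of \<open>f\<close> with \<open>z\<^sup>n\<close>, where \<open>a\<^sub>n\<close> is the Taylor coefficient. Expanding the kernels by the negative binomial series
  then yields the reproducing property: pairing \<open>f\<close> with the \<open>j\<close>-th \<open>w\<close>-bar derivative of \<open>k\<^sub>w\<close>
  gives the \<open>j\<close>-th derivative of \<open>f\<close> at \<open>w\<close>. Hence the vanishing space is the orthogonal complement of the generalised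
  kernels, equivalently of the \<open>B\<^sub>k\<close>. Completeness of the Bergman space, which follows from the
  pointwise bounds and Fatou's lemma, together with Bessel's inequality makes the orthogonal
  expansion converge.
\<close>

subsection \<open>Integration over discs\<close>

lemma nn_integral_lborel_shift:
  fixes f :: "'a::euclidean_space \<Rightarrow> ennreal"
  assumes [measurable]: "f \<in> borel_measurable borel"
  shows "(\<integral>\<^sup>+x. f (c + x) \<partial>lborel) = (\<integral>\<^sup>+x. f x \<partial>lborel)"
proof -
  have "(\<integral>\<^sup>+x. f x \<partial>lborel) = (\<integral>\<^sup>+x. f x \<partial>distr lborel borel ((+) c))"
    by (simp add: lborel_distr_plus)
  also have "\<dots> = (\<integral>\<^sup>+x. f (c + x) \<partial>lborel)"
    by (rule nn_integral_distr) auto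
  finally show ?thesis by simp
qed

text \<open>
  Uniqueness of Haar measure: for the unit ball \<open>B\<close>, both orders of integration of
  \<open>(x, y) \<mapsto> 1\<^sub>B(x) 1\<^sub>A(T y + x)\<close> can be evaluated by translation invariance, because
  \<open>T\<close> preserves \<open>B\<close>.
\<close>

lemma lborel_distr_linear_isometry:
  fixes T :: "'a::euclidean_space \<Rightarrow> 'a"
  assumes T: "linear T" "\<And>x. norm (T x) = norm x" and TT: "\<And>x. T (T' x) = x"
  shows "distr lborel borel T = lborel"
proof (rule measure_eqI)
  have meas [measurable]: "T \<in> borel_measurable borel"
    using T(1) by (intro borel_measurable_continuous_onI linear_continuous_on linear_linear[THEN iffD2])
  have add: "T (x + y) = T x + T y" for x y
    using T(1) by (rule linear_add)
  fix A assume "A \<in> sets (distr lborel borel T)"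
  hence A [measurable]: "A \<in> sets borel" by simp
  define B :: "'a set" where "B = ball 0 1"
  have B [measurable]: "B \<in> sets borel" by (simp add: B_def)
  \<comment> \<open>Since \<open>x = T (T' x)\<close>, the translation by \<open>x\<close> after
    \<open>T\<close> is the translation by \<open>T' x\<close> before it.\<close>
  have shiftT: "(\<integral>\<^sup>+y. h (T y + x) \<partial>lborel) = (\<integral>\<^sup>+y. h (T y) \<partial>lborel)"
    if [measurable]: "h \<in> borel_measurable borel" for h :: "'a \<Rightarrow> ennreal" and x
  proof -
    have "(\<integral>\<^sup>+y. h (T (T' x + y)) \<partial>lborel) = (\<integral>\<^sup>+y. h (T y) \<partial>lborel)"
      by (rule nn_integral_lborel_shift) measurable
    thus ?thesis by (simp add: add TT add.commute)
  qed
  have shift: "(\<integral>\<^sup>+x. h (x - T y) \<partial>lborel) = (\<integral>\<^sup>+x. h x \<partial>lborel)"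
    if "h \<in> borel_measurable borel" for h :: "'a \<Rightarrow> ennreal" and y
    using nn_integral_lborel_shift[OF that, of "- T y"] by simp
  have "emeasure lborel B * (\<integral>\<^sup>+y. indicator A (T y) \<partial>lborel) =
      (\<integral>\<^sup>+x. indicator B x * (\<integral>\<^sup>+y. indicator A (T y) \<partial>lborel) \<partial>lborel)"
    by (subst nn_integral_multc) auto
  also have "\<dots> = (\<integral>\<^sup>+x. indicator B x * (\<integral>\<^sup>+y. indicator A (T y + x) \<partial>lborel) \<partial>lborel)"
    by (simp add: shiftT[of "indicator A"])
  also have "\<dots> = (\<integral>\<^sup>+x. (\<integral>\<^sup>+y. indicator B x * indicator A (T y + x) \<partial>lborel) \<partial>lborel)"
    by (intro nn_integral_cong nn_integral_cmult[symmetric]) measurable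
  also have "\<dots> = (\<integral>\<^sup>+y. (\<integral>\<^sup>+x. indicator B x * indicator A (T y + x) \<partial>lborel) \<partial>lborel)"
    by (rule lborel_pair.Fubini'[symmetric]) measurable
  \<comment> \<open>For fixed \<open>y\<close>, the substitution of \<open>x - T y\<close> for
    \<open>x\<close> frees \<open>A\<close> from \<open>T\<close>.\<close>
  also have "\<dots> = (\<integral>\<^sup>+y. (\<integral>\<^sup>+x. indicator B (x - T y) * indicator A x \<partial>lborel) \<partial>lborel)"
  proof (rule nn_integral_cong)
    fix y
    show "(\<integral>\<^sup>+x. indicator B x * indicator A (T y + x) \<partial>lborel) =
        (\<integral>\<^sup>+x. indicator B (x - T y) * indicator A x \<partial>lborel)"
      by (subst shift[of "\<lambda>x. indicator B x * indicator A (T y + x)" y, symmetric]) auto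
  qed
  also have "\<dots> = (\<integral>\<^sup>+x. (\<integral>\<^sup>+y. indicator B (x - T y) * indicator A x \<partial>lborel) \<partial>lborel)"
    by (rule lborel_pair.Fubini') measurable
  also have "\<dots> = (\<integral>\<^sup>+x. (\<integral>\<^sup>+y. indicator B (x - T y) \<partial>lborel) * indicator A x \<partial>lborel)"
    by (intro nn_integral_cong nn_integral_multc) measurable
  \<comment> \<open>Independence of \<open>x\<close> comes from the symmetry of \<open>B\<close>
    under negation followed by \<open>shiftT\<close>; the value then comes from \<open>T\<close>
    preserving \<open>B\<close>.\<close>
  also have "(\<lambda>x. \<integral>\<^sup>+y. indicator B (x - T y) \<partial>lborel) = (\<lambda>x. emeasure lborel B)"
  proof
    fix x
    have "(\<integral>\<^sup>+y. indicator B (x - T y) \<partial>lborel) = (\<integral>\<^sup>+y. indicator B (T y + (- x)) \<partial>lborel)"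
      by (intro nn_integral_cong) (auto simp: B_def indicator_def norm_minus_commute)
    also have "\<dots> = (\<integral>\<^sup>+y. indicator B (T y) \<partial>lborel)"
      by (rule shiftT) measurable
    also have "\<dots> = (\<integral>\<^sup>+y. indicator B y \<partial>lborel)"
      by (intro nn_integral_cong) (auto simp: B_def indicator_def T)
    finally show "(\<integral>\<^sup>+y. indicator B (x - T y) \<partial>lborel) = emeasure lborel B" by simp
  qed
  also have "(\<integral>\<^sup>+x. emeasure lborel B * indicator A x \<partial>lborel) = emeasure lborel B * emeasure lborel A"
    by (subst nn_integral_cmult) auto
  finally have eq: "emeasure lborel B * (\<integral>\<^sup>+y. indicator A (T y) \<partial>lborel) =
      emeasure lborel B * emeasure lborel A" .
  have "emeasure lborel B \<noteq> 0" "emeasure lborel B \<noteq> \<infinity>"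
    using content_ball_pos[of 1 "0 :: 'a"] emeasure_lborel_ball_finite[of "0 :: 'a" 1]
    by (auto simp: B_def measure_def)
  hence "(\<integral>\<^sup>+y. indicator A (T y) \<partial>lborel) = emeasure lborel A"
    using eq by (simp add: ennreal_mult_cancel_left)
  moreover have "emeasure (distr lborel borel T) A = (\<integral>\<^sup>+y. indicator A (T y) \<partial>lborel)"
  proof -
    have "emeasure (distr lborel borel T) A = (\<integral>\<^sup>+y. indicator A y \<partial>distr lborel borel T)"
      by simp
    also have "\<dots> = (\<integral>\<^sup>+y. indicator A (T y) \<partial>lborel)"
      by (rule nn_integral_distr) auto
    finally show ?thesis .
  qed
  ultimately show "emeasure (distr lborel borel T) A = emeasure lborel A" by simp
qed simp

text \<open>A substitute for polar coordinates: the part of the disc where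
  \<open>(cmod z)^2 > x\<close> has area \<open>pi * (r^2 - x)\<close>, which is linear in
  \<open>x\<close>, so the squared modulus is uniformly distributed. Comparing the measures on upper
  half-lines suffices because they are finite there.\<close>

lemma distr_cmod_squared:
  assumes r: "r \<ge> 0"
  shows "distr (density lborel (\<lambda>z. indicator (ball 0 r) z)) borel (\<lambda>z. (cmod z)\<^sup>2) =
    density lborel (\<lambda>x. ennreal pi * indicator {0..r\<^sup>2} x)" (is "?M = ?N")
proof (rule measure_eqI_lessThan)
  have M: "emeasure ?M {x<..} = emeasure lborel {z\<in>ball 0 r. x < (cmod z)\<^sup>2}" for x
  proof -
    have S: "{z. x < (cmod z)\<^sup>2} \<in> sets borel" by measurable
    have "emeasure ?M {x<..} = emeasure (density lborel (\<lambda>z. indicator (ball 0 r) z)) {z. x < (cmod z)\<^sup>2}"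
      by (subst emeasure_distr) (auto simp: vimage_def)
    also have "\<dots> = (\<integral>\<^sup>+z. indicator {z\<in>ball 0 r. x < (cmod z)\<^sup>2} z \<partial>lborel)"
      using S by (subst emeasure_density)
        (auto intro!: nn_integral_cong borel_measurable_indicator simp: indicator_def[abs_def])
    also have "\<dots> = emeasure lborel {z\<in>ball 0 r. x < (cmod z)\<^sup>2}"
      by (rule nn_integral_indicator) measurable
    finally show ?thesis .
  qed
  have ball: "emeasure lborel (ball (0::complex) r) = ennreal (pi * r\<^sup>2)"
    using r by (simp add: emeasure_ball unit_ball_vol_2)
  fix x
  show "emeasure ?M {x<..} < \<infinity>"
  proof -
    have "emeasure ?M {x<..} \<le> emeasure lborel (ball (0::complex) r)"
      unfolding M by (intro emeasure_mono) auto
    thus ?thesis unfolding ball by (rule order.strict_trans1) simp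
  qed
  have N: "emeasure ?N {x<..} = ennreal pi * emeasure lborel ({0..r\<^sup>2} \<inter> {x<..})"
  proof -
    have "emeasure ?N {x<..} = (\<integral>\<^sup>+y. ennreal pi * indicator ({0..r\<^sup>2} \<inter> {x<..}) y \<partial>lborel)"
      by (subst emeasure_density) (auto intro!: nn_integral_cong simp: indicator_def)
    thus ?thesis by (simp add: nn_integral_cmult)
  qed
  consider "x < 0" | "x \<ge> 0" "x \<le> r\<^sup>2" | "x > r\<^sup>2" by linarith
  thus "emeasure ?M {x<..} = emeasure ?N {x<..}"
  proof cases
    case 1
    hence "{z\<in>ball 0 r. x < (cmod z)\<^sup>2} = ball 0 r" "{0..r\<^sup>2} \<inter> {x<..} = {0..r\<^sup>2}"
      by (auto intro: less_le_trans)
    thus ?thesis unfolding M N by (simp add: ball ennreal_mult')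
  next
    case 2
    have sq: "sqrt x \<le> r"
      using 2 r by (simp add: real_le_lsqrt)
    have lt: "x < (cmod z)\<^sup>2 \<longleftrightarrow> sqrt x < cmod z" for z
      using 2 real_less_lsqrt real_less_rsqrt
      by (metis linorder_not_less norm_ge_zero real_sqrt_abs abs_norm_cancel real_sqrt_less_iff)
    \<comment> \<open>\<open>C\<close> is the part to be removed. At \<open>sqrt x = r\<close> the
      closed disc would not fit into the open ball, so the whole ball is removed instead; the area
      is \<open>pi * x\<close> either way.\<close>
    define C where "C = (if sqrt x < r then cball (0::complex) (sqrt x) else ball 0 r)"
    have C: "C \<in> sets lborel" "C \<subseteq> ball 0 r" "emeasure lborel C = ennreal (pi * x)"
      using 2 sq ball by (auto simp: C_def emeasure_cball unit_ball_vol_2)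
    have "emeasure lborel {z\<in>ball 0 r. x < (cmod z)\<^sup>2} = emeasure lborel (ball 0 r - C)"
      using sq by (intro arg_cong[of _ _ "emeasure lborel"]) (auto simp: lt C_def)
    also have "\<dots> = emeasure lborel (ball (0::complex) r) - ennreal (pi * x)"
      using C by (subst emeasure_Diff) auto
    finally have A: "emeasure ?M {x<..} = ennreal (pi * r\<^sup>2 - pi * x)"
      unfolding M ball using 2 by (simp add: ennreal_minus)
    have "{0..r\<^sup>2} \<inter> {x<..} = {x<..r\<^sup>2}" using 2 by auto
    hence "emeasure ?N {x<..} = ennreal (pi * (r\<^sup>2 - x))"
      unfolding N using 2 by (simp add: ennreal_mult')
    thus ?thesis by (simp only: A right_diff_distrib)
  next
    case 3
    have "(cmod z)\<^sup>2 \<le> r\<^sup>2" if "z \<in> ball 0 r" for z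
      using that by (intro power_mono) auto
    hence "{z\<in>ball 0 r. x < (cmod z)\<^sup>2} = {}" "{0..r\<^sup>2} \<inter> {x<..} = {}"
      using 3 by force+
    thus ?thesis unfolding M N by (simp only: emeasure_empty mult_zero_right)
  qed
qed auto

text \<open>The integrand is the \<open>n\<close>-th power of the squared modulus, so the
  push-forward reduces the claim to integrating \<open>pi * x ^ n\<close> over the interval from 0
  to \<open>r^2\<close>.\<close>

lemma integral_cmod_power_ball:
  assumes r: "r \<ge> 0"
  shows "(\<integral>z. indicator (ball 0 r) z *\<^sub>R (cmod z) ^ (2 * n) \<partial>lborel) = pi * r ^ (2 * n + 2) / real (n + 1)"
proof -
  have "(\<integral>z. indicator (ball 0 r) z *\<^sub>R (cmod z) ^ (2 * n) \<partial>lborel) =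
      (\<integral>z. ((cmod z)\<^sup>2) ^ n \<partial>density lborel (\<lambda>z. ennreal (indicator (ball 0 r) z)))"
    by (subst integral_density) (auto simp: power_mult intro!: borel_measurable_indicator)
  also have "\<dots> = (\<integral>x. x ^ n \<partial>distr (density lborel (\<lambda>z. indicator (ball 0 r) z)) borel (\<lambda>z. (cmod z)\<^sup>2))"
    by (subst integral_distr) (auto simp: ennreal_indicator)
  also have "\<dots> = (\<integral>x. x ^ n \<partial>density lborel (\<lambda>x. ennreal (pi * indicator {0..r\<^sup>2} x)))"
    by (simp only: distr_cmod_squared[OF r]) (simp add: ennreal_mult' ennreal_indicator)
  also have "\<dots> = (\<integral>x. pi * (x ^ n * indicator {0..r\<^sup>2} x) \<partial>lborel)"
  proof -
    have "(\<integral>x. x ^ n \<partial>density lborel (\<lambda>x. ennreal (pi * indicator {0..r\<^sup>2} x))) =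
        (\<integral>x. (pi * indicator {0..r\<^sup>2} x) *\<^sub>R x ^ n \<partial>lborel)"
      by (rule integral_density) auto
    also have "\<dots> = (\<integral>x. pi * (x ^ n * indicator {0..r\<^sup>2} x) \<partial>lborel)"
      by (rule Bochner_Integration.integral_cong) auto
    finally show ?thesis .
  qed
  also have "\<dots> = pi * (((r\<^sup>2) ^ Suc n - 0 ^ Suc n) / Suc n)"
    by (subst integral_mult_right_zero, subst integral_power) simp_all
  also have "\<dots> = pi * r ^ (2 * n + 2) / real (n + 1)"
    by (simp add: power_mult[symmetric] flip: power_add)
  finally show ?thesis .
qed

section \<open>Rotations and orthogonality of monomials\<close>

lemma integral_lborel_rotation:
  fixes f :: "complex \<Rightarrow> 'b::{banach, second_countable_topology}"
  assumes [measurable]: "f \<in> borel_measurable borel" and c: "cmod c = 1"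
  shows "(\<integral>z. f (c * z) \<partial>lborel) = (\<integral>z. f z \<partial>lborel)"
proof -
  have "distr lborel borel ((*) c) = lborel"
    using c by (intro lborel_distr_linear_isometry[where T' = "\<lambda>z. z / c"])
      (auto simp: norm_mult intro!: bounded_linear.linear bounded_linear_mult_right)
  hence "(\<integral>z. f z \<partial>lborel) = (\<integral>z. f z \<partial>distr lborel borel ((*) c))" by simp
  also have "\<dots> = (\<integral>z. f (c * z) \<partial>lborel)"
    by (rule integral_distr) auto
  finally show ?thesis by simp
qed

text \<open>Orthogonality holds on every disc around 0, so termwise integration of a power series
  against \<open>cnj z ^ n\<close> isolates a single coefficient. The diagonal case is
  radial.\<close>

lemma integral_monomials_ball:
  assumes r: "r \<ge> 0"
  shows "(\<integral>z. indicator (ball 0 r) z *\<^sub>R (z ^ m * cnj z ^ n) \<partial>lborel) =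
    (if m = n then of_real (pi * r ^ (2 * n + 2) / real (n + 1)) else 0)"
proof (cases "m = n")
  case True
  have "(\<integral>z. indicator (ball 0 r) z *\<^sub>R (z ^ m * cnj z ^ n) \<partial>lborel) =
     (\<integral>z. complex_of_real (indicator (ball 0 r) z *\<^sub>R (cmod z) ^ (2 * n)) \<partial>lborel)"
    by (intro Bochner_Integration.integral_cong)
      (auto simp: True power_mult_distrib[symmetric] complex_norm_square[symmetric] power_mult
        indicator_def)
  thus ?thesis unfolding integral_complex_of_real integral_cmod_power_ball[OF r] using True by simp
next
  case False
  \<comment> \<open>The rotation by \<open>\<pi> / (m - n)\<close> changes the sign of the integrand.\<close>
  define t where "t = pi / (real m - real n)"
  define c where "c = cis t"
  let ?f = "\<lambda>z. indicator (ball 0 r) z *\<^sub>R (z ^ m * cnj z ^ n)"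
  have cn: "cmod c = 1" by (simp add: c_def)
  have "c ^ m * cnj c ^ n = cis (real m * t) * cis (- (real n * t))"
    by (simp add: c_def cis_cnj Complex.DeMoivre)
  also have "\<dots> = cis ((real m - real n) * t)" by (simp add: cis_mult left_diff_distrib)
  also have "\<dots> = -1" using False by (simp add: t_def cis_pi)
  finally have cc: "c ^ m * cnj c ^ n = -1" .
  have "(\<integral>z. ?f z \<partial>lborel) = (\<integral>z. ?f (c * z) \<partial>lborel)"
    by (rule integral_lborel_rotation[symmetric, OF _ cn]) 
       (intro borel_measurable_continuous_on_indicator continuous_intros, simp)
  also have "\<dots> = (\<integral>z. (c ^ m * cnj c ^ n) * ?f z \<partial>lborel)"
    by (intro Bochner_Integration.integral_cong)
       (auto simp: indicator_def norm_mult cn power_mult_distrib)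
  also have "\<dots> = - (\<integral>z. ?f z \<partial>lborel)" by (simp add: cc)
  finally have "(\<integral>z. ?f z \<partial>lborel) = 0" by simp
  thus ?thesis using False by simp
qed

text \<open>Termwise integration with the summable majorant \<open>cmod (F x) * b n\<close>. The
  conditions on \<open>g\<close> are restricted to points where \<open>F\<close> is nonzero, so that
  \<open>F\<close> can carry the cutoff to a disc.\<close>

lemma sums_integral_mult:
  fixes F G :: "'a \<Rightarrow> complex" and g :: "nat \<Rightarrow> 'a \<Rightarrow> complex"
  assumes F: "integrable M F" and g [measurable]: "\<And>n. g n \<in> borel_measurable M"
    and bound: "\<And>n x. F x \<noteq> 0 \<Longrightarrow> cmod (g n x) \<le> b n" and b: "summable b"
    and sums: "\<And>x. F x \<noteq> 0 \<Longrightarrow> (\<lambda>n. g n x) sums G x"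
  shows "(\<lambda>n. \<integral>x. F x * g n x \<partial>M) sums (\<integral>x. F x * G x \<partial>M)"
proof -
  note [measurable] = borel_measurable_integrable[OF F]
  have le: "cmod (F x * g n x) \<le> cmod (F x) * b n" for x n
    using bound[of x n] by (cases "F x = 0") (auto simp: norm_mult intro: mult_left_mono)
  have int: "integrable M (\<lambda>x. F x * g n x)" for n
  proof (rule Bochner_Integration.integrable_bound)
    show "integrable M (\<lambda>x. cmod (F x) * b n)"
      by (intro integrable_mult_left integrable_norm F)
  qed (use le in \<open>auto intro: order_trans[OF _ abs_ge_self]\<close>)
  have eq: "(\<Sum>n. F x * g n x) = F x * G x" and summ: "summable (\<lambda>n. F x * g n x)" for x
    using sums_mult[OF sums, of x "F x"] by (cases "F x = 0"; simp add: sums_iff)+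
  have "(\<lambda>n. \<integral>x. F x * g n x \<partial>M) sums (\<integral>x. (\<Sum>n. F x * g n x) \<partial>M)"
  proof (rule sums_integral)
    show "AE x in M. summable (\<lambda>n. norm (F x * g n x))"
      by (intro always_eventually allI summable_comparison_test'[OF summable_mult[OF b]])
         (use le in auto)
    show "summable (\<lambda>n. \<integral>x. norm (F x * g n x) \<partial>M)"
    proof (rule summable_comparison_test'[OF summable_mult[OF b]])
      fix n
      have "(\<integral>x. norm (F x * g n x) \<partial>M) \<le> (\<integral>x. norm (F x) * b n \<partial>M)"
        by (intro integral_mono integrable_norm int integrable_mult_left F le)
      thus "norm (\<integral>x. norm (F x * g n x) \<partial>M) \<le> (\<integral>x. norm (F x) \<partial>M) * b n"
        by simp
    qed
  qed (rule int)
  thus ?thesis by (simp add: eq)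
qed

subsection \<open>The reproducing property\<close>

lemma bergman_fun_bounded:
  assumes hol: "f holomorphic_on unit_disc" and zero: "\<And>z. z \<notin> unit_disc \<Longrightarrow> f z = 0"
    and bound: "\<And>z. z \<in> unit_disc \<Longrightarrow> cmod (f z) \<le> C"
  shows "bergman_fun f" "(\<integral>z. (cmod (f z))\<^sup>2 \<partial>lborel) \<le> pi * C\<^sup>2"
proof -
  have "(\<lambda>z. indicator unit_disc z *\<^sub>R f z) \<in> borel_measurable borel"
    by (intro borel_measurable_continuous_on_indicator holomorphic_on_imp_continuous_on hol) auto
  also have "(\<lambda>z. indicator unit_disc z *\<^sub>R f z) = f"
    using zero by (auto simp: indicator_def fun_eq_iff)
  finally have [measurable]: "f \<in> borel_measurable borel" .
  have le: "(cmod (f z))\<^sup>2 \<le> indicator unit_disc z *\<^sub>R C\<^sup>2" for z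
    using power_mono[OF bound, of z 2] zero[of z] by (cases "z \<in> unit_disc") auto
  have int': "integrable lborel (\<lambda>z::complex. indicator unit_disc z *\<^sub>R C\<^sup>2)"
    by (intro integrable_scaleR_left integrable_real_indicator)
      (use emeasure_lborel_ball_finite[of "0 :: complex" 1] in \<open>auto simp: top.not_eq_extremum\<close>)
  have int: "integrable lborel (\<lambda>z. (cmod (f z))\<^sup>2)"
  proof (rule Bochner_Integration.integrable_bound[OF int'])
    show "AE z in lborel. norm ((cmod (f z))\<^sup>2) \<le> norm (indicator unit_disc z *\<^sub>R C\<^sup>2)"
      by (intro always_eventually allI)
        (simp only: real_norm_def abs_power2, rule order_trans[OF le abs_ge_self])
  qed measurable
  show "bergman_fun f" by (rule bergman_funI[OF hol zero int])
  have "(\<integral>z. (cmod (f z))\<^sup>2 \<partial>lborel) \<le> (\<integral>z. indicator unit_disc (z::complex) *\<^sub>R C\<^sup>2 \<partial>lborel)"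
    by (intro integral_mono int int' le)
  also have "\<dots> = measure lborel (unit_disc) * C\<^sup>2" by simp
  also have "\<dots> = pi * C\<^sup>2" by (simp add: content_ball unit_ball_vol_2)
  finally show "(\<integral>z. (cmod (f z))\<^sup>2 \<partial>lborel) \<le> pi * C\<^sup>2" .
qed

text \<open>The monomial cut off outside the disc is itself a Bergman function. The case
  \<open>n = 0\<close> gives integrability of \<open>f\<close>.\<close>

lemma bergman_fun_integrable_mult_monomial:
  assumes "bergman_fun f"
  shows "integrable lborel (\<lambda>z. f z * cnj z ^ n)"
proof -
  have zero: "\<And>z. z \<notin> unit_disc \<Longrightarrow> f z = 0" using assms by (auto simp: bergman_fun_def)
  let ?g = "\<lambda>z. if z \<in> unit_disc then z ^ n else 0"
  have "bergman_fun ?g"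
  proof (rule bergman_fun_bounded(1))
    have "(\<lambda>z. z ^ n) holomorphic_on unit_disc" by (intro holomorphic_intros)
    thus "?g holomorphic_on unit_disc" by (rule holomorphic_transform) simp
    show "cmod (?g z) \<le> 1" if "z \<in> unit_disc" for z
      using that by (auto simp: norm_power intro: power_le_one)
  qed auto
  from bergman_fun_mult_integrable[OF assms this]
  have "integrable lborel (\<lambda>z. f z * cnj (?g z))" .
  also have "(\<lambda>z. f z * cnj (?g z)) = (\<lambda>z. f z * cnj z ^ n)"
    using zero by (auto simp: fun_eq_iff)
  finally show ?thesis .
qed

text \<open>On a disc of radius below 1 the Taylor series has a summable majorant, so it may be
  integrated termwise, and orthogonality leaves only the term \<open>m = n\<close>.\<close>

lemma integral_mult_monomial_ball:
  assumes hol: "f holomorphic_on unit_disc" and r: "0 < r" "r < 1"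
  shows "(\<integral>z. indicator (ball 0 r) z *\<^sub>R (f z * cnj z ^ n) \<partial>lborel) =
    (deriv ^^ n) f 0 / fact n * of_real (pi * r ^ (2 * n + 2) / real (n + 1))"
proof -
  define a where "a = (\<lambda>m. (deriv ^^ m) f 0 / fact m)"
  have ser: "(\<lambda>m. a m * z ^ m) sums f z" if "z \<in> unit_disc" for z
    using holomorphic_power_series[OF hol that] by (simp add: a_def)
  have "summable (\<lambda>m. norm (a m * of_real r ^ m))"
  proof (rule powser_insidea)
    \<comment> \<open>The midpoint of \<open>r\<close> and 1 is still in the disc; convergence there
      forces absolute convergence at the smaller radius \<open>r\<close>.\<close>
    have "complex_of_real ((1 + r) / 2) \<in> unit_disc"
      using r unfolding mem_ball_0 norm_of_real by auto
    from ser[OF this] show "summable (\<lambda>m. a m * of_real ((1 + r) / 2) ^ m)"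
      by (rule sums_summable)
    show "norm (of_real r :: complex) < norm (of_real ((1 + r) / 2) :: complex)"
      using r unfolding norm_of_real by auto
  qed
  hence summ: "summable (\<lambda>m. cmod (a m) * r ^ m)"
    using r by (simp add: norm_mult norm_power)
  let ?F = "\<lambda>z. indicator (ball 0 r) z *\<^sub>R cnj z ^ n"
  have "(\<lambda>m. \<integral>z. ?F z * (a m * z ^ m) \<partial>lborel) sums (\<integral>z. ?F z * f z \<partial>lborel)"
  proof (rule sums_integral_mult[OF _ _ _ summ])
    have meas: "?F \<in> borel_measurable borel"
      by (intro borel_measurable_continuous_on_indicator continuous_intros) auto
    have le: "norm (?F z) \<le> norm (indicator (ball 0 r) z :: real)" for z
      using r by (auto simp: indicator_def norm_power intro!: power_le_one)
    have fin: "emeasure lborel (ball 0 r :: complex set) < \<infinity>"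
      using emeasure_lborel_ball_finite[of "0 :: complex" r] by (simp add: top.not_eq_extremum)
    have "integrable lborel (\<lambda>z. indicator (ball 0 r :: complex set) z :: real)"
      by (rule integrable_real_indicator) (use fin in auto)
    thus "integrable lborel ?F"
      by (rule Bochner_Integration.integrable_bound)
        (use meas le in \<open>simp_all only: measurable_lborel2 always_eventually simp_thms\<close>)
    show "(\<lambda>z. a m * z ^ m) \<in> borel_measurable lborel" for m by measurable
    show "cmod (a m * z ^ m) \<le> cmod (a m) * r ^ m" if "?F z \<noteq> 0" for m z
      using that by (auto simp: norm_mult norm_power indicator_def intro!: mult_left_mono power_mono
        split: if_splits)
    show "(\<lambda>m. a m * z ^ m) sums f z" if "?F z \<noteq> 0" for z
      using that r by (intro ser) (auto simp: indicator_def split: if_splits)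
  qed
  also have "(\<lambda>m. \<integral>z. ?F z * (a m * z ^ m) \<partial>lborel) =
     (\<lambda>m. if m = n then a m * of_real (pi * r ^ (2 * n + 2) / real (n + 1)) else 0)"
  proof
    fix m
    have "(\<integral>z. ?F z * (a m * z ^ m) \<partial>lborel) =
        (\<integral>z. a m * (indicator (ball 0 r) z *\<^sub>R (z ^ m * cnj z ^ n)) \<partial>lborel)"
      by (intro Bochner_Integration.integral_cong) auto
    also have "\<dots> = a m * (\<integral>z. indicator (ball 0 r) z *\<^sub>R (z ^ m * cnj z ^ n) \<partial>lborel)"
      by (rule integral_mult_right_zero)
    also have "\<dots> = (if m = n then a m * of_real (pi * r ^ (2 * n + 2) / real (n + 1)) else 0)"
      using r by (subst integral_monomials_ball) auto
    finally show "(\<integral>z. ?F z * (a m * z ^ m) \<partial>lborel) = \<dots>" .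
  qed
  finally have "(\<integral>z. ?F z * f z \<partial>lborel) = a n * of_real (pi * r ^ (2 * n + 2) / real (n + 1))"
    by (rule sums_unique2[OF _ sums_single])
  moreover have "(\<lambda>z. ?F z * f z) = (\<lambda>z. indicator (ball 0 r) z *\<^sub>R (f z * cnj z ^ n))"
    by (auto simp: fun_eq_iff)
  ultimately show ?thesis by (simp only: a_def)
qed

text \<open>The Taylor series need not have a summable majorant on the whole disc, hence the
  exhaustion by smaller discs. Dominated convergence applies with the modulus of the integrand as
  majorant.\<close>

lemma integral_mult_monomial:
  assumes f: "bergman_fun f"
  shows "(\<integral>z. f z * cnj z ^ n \<partial>lborel) = (deriv ^^ n) f 0 / fact n * of_real (pi / real (n + 1))"
proof -
  have hol: "f holomorphic_on unit_disc" and zero: "\<And>z. z \<notin> unit_disc \<Longrightarrow> f z = 0"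
    using f by (auto simp: bergman_fun_def)
  note int = bergman_fun_integrable_mult_monomial[OF f, of n]
  \<comment> \<open>The shift by 2 makes the first radius 1/2 rather than 0, as the radii must be
    positive.\<close>
  define r where "r = (\<lambda>k. 1 - inverse (real (k + 2)))"
  have r: "0 < r k" "r k < 1" for k by (auto simp: r_def field_simps)
  have lim: "r \<longlonglongrightarrow> 1" unfolding r_def by real_asymp
  have "(\<lambda>k. \<integral>z. indicator (ball 0 (r k)) z *\<^sub>R (f z * cnj z ^ n) \<partial>lborel)
      \<longlonglongrightarrow> (\<integral>z. f z * cnj z ^ n \<partial>lborel)"
  proof (rule integral_dominated_convergence[where w = "\<lambda>z. cmod (f z * cnj z ^ n)"])
    show "AE z in lborel. (\<lambda>k. indicator (ball 0 (r k)) z *\<^sub>R (f z * cnj z ^ n))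
        \<longlonglongrightarrow> f z * cnj z ^ n"
    proof (intro always_eventually allI)
      fix z
      show "(\<lambda>k. indicator (ball 0 (r k)) z *\<^sub>R (f z * cnj z ^ n)) \<longlonglongrightarrow> f z * cnj z ^ n"
      proof (cases "z \<in> unit_disc")
        case True
        hence "\<forall>\<^sub>F k in sequentially. cmod z < r k"
          using order_tendstoD(1)[OF lim, of "cmod z"] by simp
        hence "\<forall>\<^sub>F k in sequentially. indicator (ball 0 (r k)) z *\<^sub>R (f z * cnj z ^ n) = f z * cnj z ^ n"
          by eventually_elim simp
        thus ?thesis by (rule tendsto_eventually)
      qed (simp add: zero)
    qed
    show "(\<lambda>z. f z * cnj z ^ n) \<in> borel_measurable lborel" using int by auto
    thus "(\<lambda>z. indicator (ball 0 (r k)) z *\<^sub>R (f z * cnj z ^ n)) \<in> borel_measurable lborel" for k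
      by (auto intro!: borel_measurable_scaleR borel_measurable_indicator)
  qed (use int in \<open>auto simp: indicator_def\<close>)
  moreover have "(\<lambda>k. \<integral>z. indicator (ball 0 (r k)) z *\<^sub>R (f z * cnj z ^ n) \<partial>lborel)
      \<longlonglongrightarrow> (deriv ^^ n) f 0 / fact n * of_real (pi * 1 ^ (2 * n + 2) / real (n + 1))"
    unfolding integral_mult_monomial_ball[OF hol r]
    by (intro tendsto_intros lim) auto
  ultimately have "(\<integral>z. f z * cnj z ^ n \<partial>lborel) =
      (deriv ^^ n) f 0 / fact n * of_real (pi * 1 ^ (2 * n + 2) / real (n + 1))"
    by (rule LIMSEQ_unique)
  thus ?thesis by simp
qed

text \<open>This is the binomial series with exponent \<open>-(j + 2)\<close> at \<open>- x\<close>: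
  the sign from negating the upper index cancels the sign of \<open>(- x) ^ m\<close>. At
  \<open>x = w * cnj z\<close> it expands the differentiated kernel.\<close>

lemma negative_binomial_sums:
  fixes x :: complex
  assumes "cmod x < 1"
  shows "(\<lambda>m. fact (m + j + 1) / fact m * x ^ m) sums (fact (Suc j) / (1 - x) ^ (j + 2))"
proof -
  have "(\<lambda>m. fact (Suc j) * ((- of_nat (j + 2) gchoose m) * (- x) ^ m)) sums
      (fact (Suc j) * (1 + - x) powr (- of_nat (j + 2)))"
    using assms by (intro sums_mult gen_binomial_complex) auto
  also have "(\<lambda>m. fact (Suc j) * ((- of_nat (j + 2) gchoose m) * (- x) ^ m)) =
     (\<lambda>m. fact (m + j + 1) / fact m * x ^ m)"
  proof
    fix m
    have "(- of_nat (j + 2) gchoose m) = (-1) ^ m * (of_nat (m + j + 1) gchoose m :: complex)"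
      by (subst gbinomial_minus) (simp add: algebra_simps)
    also have "(of_nat (m + j + 1) gchoose m :: complex) = fact (m + j + 1) / (fact m * fact (Suc j))"
      unfolding binomial_gbinomial[symmetric] by (subst binomial_fact) auto
    finally have 1: "(- of_nat (j + 2) gchoose m) = (-1) ^ m * (fact (m + j + 1) / (fact m * fact (Suc j)) :: complex)" .
    have 2: "(- 1) ^ m * (- 1) ^ m = (1 :: complex)"
      by (simp flip: power_mult_distrib)
    show "fact (Suc j) * ((- of_nat (j + 2) gchoose m) * (- x) ^ m) = fact (m + j + 1) / fact m * x ^ m"
      unfolding 1 power_minus[of x] using 2 by (simp add: field_simps del: fact_Suc)
  qed
  also have "fact (Suc j) * (1 + - x) powr (- of_nat (j + 2)) = fact (Suc j) / (1 - x) ^ (j + 2)"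
  proof -
    have "1 - x \<noteq> 0" using assms by auto
    hence "(1 - x) powr (- of_nat (j + 2)) = inverse ((1 - x) ^ (j + 2))"
      unfolding powr_minus by (subst powr_nat) auto
    thus ?thesis by (simp add: divide_inverse)
  qed
  finally show ?thesis .
qed

text \<open>Integrating the kernel expansion termwise against \<open>f\<close> produces the Taylor
  series around 0 of the \<open>j\<close>-th derivative of \<open>f\<close>, evaluated at
  \<open>w\<close>. The common factor \<open>pi\<close> is removed by the normalisation of the area
  measure.\<close>

lemma cinner_kernel_deriv:
  assumes w: "w \<in> unit_disc"
  shows "cinner f (kernel_deriv j w) = (deriv ^^ j) (Rep_bergman f) w"
proof -
  let ?f = "Rep_bergman f"
  have f: "bergman_fun ?f" using Rep_bergman by auto
  hence hol: "?f holomorphic_on unit_disc" and zero: "\<And>z. z \<notin> unit_disc \<Longrightarrow> ?f z = 0"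
    by (auto simp: bergman_fun_def)
  define c :: "nat \<Rightarrow> complex" where "c = (\<lambda>m. fact (m + j + 1) / fact m)"
  have ker: "(\<lambda>m. c m * w ^ m * cnj z ^ (m + j)) sums cnj (Rep_bergman (kernel_deriv j w) z)"
    if z: "z \<in> unit_disc" for z
  proof -
    have "cmod (w * cnj z) < 1"
      using w z mult_strict_mono'[of "cmod w" 1 "cmod z" 1] by (simp add: norm_mult)
    from sums_mult[OF negative_binomial_sums[OF this, of j], of "cnj z ^ j"]
    have "(\<lambda>m. c m * w ^ m * cnj z ^ (m + j)) sums (cnj z ^ j * (fact (Suc j) / (1 - w * cnj z) ^ (j + 2)))"
      by (simp add: c_def power_mult_distrib power_add mult_ac)
    also have "cnj z ^ j * (fact (Suc j) / (1 - w * cnj z) ^ (j + 2)) =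
        cnj (Rep_bergman (kernel_deriv j w) z)"
    proof -
      have "Rep_bergman (kernel_deriv j w) z = fact (Suc j) * z ^ j / (1 - cnj w * z) ^ (j + 2)"
        using w z wirtinger_cnj_bergman_kernel[OF w z, of j] by (simp only: kernel_deriv.rep_eq
            simp_thms if_True)
      thus ?thesis
        by (simp only: complex_cnj_divide complex_cnj_mult complex_cnj_power complex_cnj_diff
          complex_cnj_one complex_cnj_cnj complex_cnj_fact) (simp only: times_divide_eq_right mult.commute)
    qed
    finally show ?thesis .
  qed
  \<comment> \<open>The same series at the real point \<open>cmod w\<close> has nonnegative terms,
    so its convergence is the required absolute convergence.\<close>
  have summ: "summable (\<lambda>m. cmod (c m) * cmod w ^ m)"
  proof -
    have "(\<lambda>m. c m * of_real (cmod w) ^ m) sums (fact (Suc j) / (1 - of_real (cmod w)) ^ (j + 2))"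
      unfolding c_def by (rule negative_binomial_sums) (use w in auto)
    hence "summable (\<lambda>m. complex_of_real (fact (m + j + 1) / fact m * cmod w ^ m))"
      by (simp add: c_def sums_iff)
    hence "summable (\<lambda>m. fact (m + j + 1) / fact m * cmod w ^ m)"
      by (simp only: summable_complex_of_real)
    thus ?thesis by (simp only: c_def norm_divide norm_fact)
  qed
  have "(\<lambda>m. \<integral>z. ?f z * (c m * w ^ m * cnj z ^ (m + j)) \<partial>lborel) sums
      (\<integral>z. ?f z * cnj (Rep_bergman (kernel_deriv j w) z) \<partial>lborel)"
  proof (rule sums_integral_mult[OF _ _ _ summ ker])
    show "integrable lborel ?f"
      using bergman_fun_integrable_mult_monomial[OF f, of 0] by simp
    have "(\<lambda>z. c m * w ^ m * cnj z ^ (m + j)) \<in> borel_measurable borel" for m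
      by (intro borel_measurable_continuous_onI continuous_intros)
    thus "(\<lambda>z. c m * w ^ m * cnj z ^ (m + j)) \<in> borel_measurable lborel" for m
      by simp
    fix m z assume "?f z \<noteq> 0"
    hence z: "z \<in> unit_disc" using zero by blast
    thus "cmod (c m * w ^ m * cnj z ^ (m + j)) \<le> cmod (c m) * cmod w ^ m"
      by (simp add: norm_mult norm_power mult_left_le power_le_one)
  next
    fix z assume "?f z \<noteq> 0"
    thus "z \<in> unit_disc" using zero by blast
  qed
  also have "(\<lambda>m. \<integral>z. ?f z * (c m * w ^ m * cnj z ^ (m + j)) \<partial>lborel) =
     (\<lambda>m. of_real pi * ((deriv ^^ m) ((deriv ^^ j) ?f) 0 / fact m * (w - 0) ^ m))"
  proof
    fix m
    have "(\<integral>z. ?f z * (c m * w ^ m * cnj z ^ (m + j)) \<partial>lborel) =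
        (\<integral>z. (c m * w ^ m) * (?f z * cnj z ^ (m + j)) \<partial>lborel)"
      by (simp only: mult.left_commute)
    also have "\<dots> = c m * w ^ m * (\<integral>z. ?f z * cnj z ^ (m + j) \<partial>lborel)"
      by (rule integral_mult_right_zero)
    also have "\<dots> = c m * w ^ m * ((deriv ^^ (m + j)) ?f 0 / fact (m + j) * of_real (pi / real (m + j + 1)))"
      by (simp only: integral_mult_monomial[OF f])
    also have "\<dots> = of_real pi * ((deriv ^^ m) ((deriv ^^ j) ?f) 0 / fact m * (w - 0) ^ m)"
    proof -
      \<comment> \<open>Written this way, \<open>c m\<close> cancels both the factorial in the
        Taylor coefficient of \<open>f\<close> and the denominator \<open>m + j + 1\<close> of the
        moment, and leaves \<open>1 / fact m\<close>.\<close>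
      have "c m = fact (m + j) * of_nat (m + j + 1) / fact m"
        by (simp add: c_def)
      moreover have "F * N / G * x * (D / F * (p / N)) = p * (D / G * x)"
        if "F \<noteq> 0" "N \<noteq> 0" for F N G x D p :: complex
        using that by simp
      moreover have "of_nat (m + j + 1) \<noteq> (0::complex)"
        by (simp only: of_nat_eq_0_iff)
      ultimately show ?thesis
        by (simp only: funpow_add o_apply of_real_divide of_real_of_nat_eq diff_zero
            fact_nonzero not_False_eq_True)
    qed
    finally show "(\<integral>z. ?f z * (c m * w ^ m * cnj z ^ (m + j)) \<partial>lborel) =
       of_real pi * ((deriv ^^ m) ((deriv ^^ j) ?f) 0 / fact m * (w - 0) ^ m)" .
  qed
  finally have "(\<lambda>m. of_real pi * ((deriv ^^ m) ((deriv ^^ j) ?f) 0 / fact m * (w - 0) ^ m)) sums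
      (\<integral>z. ?f z * cnj (Rep_bergman (kernel_deriv j w) z) \<partial>lborel)" .
  moreover have "(\<lambda>m. of_real pi * ((deriv ^^ m) ((deriv ^^ j) ?f) 0 / fact m * (w - 0) ^ m)) sums
      (of_real pi * (deriv ^^ j) ?f w)"
    by (intro sums_mult holomorphic_power_series[OF _ w] holomorphic_higher_deriv hol) auto
  ultimately have "(\<integral>z. ?f z * cnj (Rep_bergman (kernel_deriv j w) z) \<partial>lborel) =
      of_real pi * (deriv ^^ j) ?f w"
    by (rule sums_unique2)
  thus ?thesis by (simp add: cinner_lborel)
qed

section \<open>Sesquilinear algebra and the complex Cauchy-Schwarz inequality\<close>

lemma cinner_add_right: "cinner f (g + h) = cinner f g + cinner f h"
  by (simp add: cinner_commute[of f] cinner_add_left)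

lemma cinner_cscale_right: "cinner f (c *\<^sub>C g) = cnj c * cinner f g"
  by (simp add: cinner_commute[of f] cinner_cscale_left)

lemma cinner_zero_left [simp]: "cinner 0 g = 0"
  using cinner_add_left[of 0 0 g] by simp

lemma cinner_zero_right [simp]: "cinner g 0 = 0"
  using cinner_add_right[of g 0 0] by simp

lemma cinner_self: "cinner f f = of_real ((norm f)\<^sup>2)"
  by (simp add: cinner_self_eq norm_bergman_lborel)

lemma norm_cscale: "norm (c *\<^sub>C f) = cmod c * norm f"
proof -
  have "complex_of_real ((norm (c *\<^sub>C f))\<^sup>2) = c * cnj c * of_real ((norm f)\<^sup>2)"
    by (simp only: cinner_self[symmetric] cinner_cscale_left cinner_cscale_right mult_ac)
  also have "\<dots> = of_real ((cmod c * norm f)\<^sup>2)"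
    by (simp only: complex_norm_square[symmetric] power_mult_distrib of_real_mult of_real_power)
  finally have "complex_of_real ((norm (c *\<^sub>C f))\<^sup>2) = of_real ((cmod c * norm f)\<^sup>2)" .
  hence "(norm (c *\<^sub>C f))\<^sup>2 = (cmod c * norm f)\<^sup>2" by (simp only: of_real_eq_iff)
  thus ?thesis by (rule power2_eq_imp_eq) auto
qed

text \<open>Multiplying \<open>f\<close> by the conjugate sign of the product makes the product real
  and nonnegative, so the real Cauchy-Schwarz inequality applies.\<close>

lemma cmod_cinner_le: "cmod (cinner f g) \<le> norm f * norm g"
proof -
  define c where "c = cnj (sgn (cinner f g))"
  have "cinner (c *\<^sub>C f) g = of_real (cmod (cinner f g))"
    by (simp add: cinner_cscale_left c_def sgn_div_norm scaleR_conv_of_real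
        complex_norm_square[symmetric] divide_simps power2_eq_square mult.commute)
  hence "cmod (cinner f g) = inner (c *\<^sub>C f) g"
    by (simp add: inner_bergman_def)
  also have "\<dots> \<le> norm (c *\<^sub>C f) * norm g"
    by (rule norm_cauchy_schwarz)
  also have "\<dots> \<le> norm f * norm g"
    by (simp add: norm_cscale c_def norm_sgn)
  finally show ?thesis .
qed

lemma bounded_linear_cinner_left: "bounded_linear (\<lambda>f. cinner f g)"
proof
  show "\<exists>K. \<forall>f. norm (cinner f g) \<le> norm f * K"
    using cmod_cinner_le by blast
qed (simp_all add: cinner_add_left scaleR_eq_cscale cinner_cscale_left scaleR_conv_of_real)

lemma bounded_linear_cscale: "bounded_linear (cscale c)"
proof
  show "\<exists>K. \<forall>f. norm (c *\<^sub>C f) \<le> norm f * K"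
    by (intro exI[of _ "cmod c"]) (simp add: norm_cscale mult.commute)
qed (simp_all add: bergman.scale_right_distrib scaleR_eq_cscale mult.commute)

lemmas cinner_diff_left = linear_diff[OF bounded_linear.linear[OF bounded_linear_cinner_left]]
lemmas cinner_sum_left = linear_sum[OF bounded_linear.linear[OF bounded_linear_cinner_left]]

section \<open>Point evaluations and the norm\<close>

lemma Rep_bergman_zero_outside: "z \<notin> unit_disc \<Longrightarrow> Rep_bergman f z = 0"
  using Rep_bergman[of f] by (auto simp: bergman_fun_def)

text \<open>Cauchy-Schwarz in the reproducing property, with the kernel norm estimated by the
  supremum of the kernel. The bound is uniform on compact subsets of the disc, which is what
  completeness uses.\<close>

lemma cmod_Rep_bergman_le:
  assumes w: "w \<in> unit_disc"
  shows "cmod (Rep_bergman f w) \<le> norm f / (1 - cmod w)\<^sup>2"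
proof -
  let ?k = "Rep_bergman (kernel_deriv 0 w)"
  have k: "bergman_fun ?k" using Rep_bergman by auto
  have pos: "1 - cmod w > 0" using w by simp
  have "cmod (?k z) \<le> 1 / (1 - cmod w)\<^sup>2" if z: "z \<in> unit_disc" for z
  proof -
    have "cmod (?k z) = 1 / (cmod (1 - cnj w * z))\<^sup>2"
      using w z by (simp add: kernel_deriv.rep_eq bergman_kernel_def norm_divide norm_power)
    also have "\<dots> \<le> 1 / (1 - cmod w)\<^sup>2"
      using pos norm_one_minus_cnj_mult(1)[OF w z] by (intro frac_le power_mono zero_less_power) auto
    finally show ?thesis .
  qed
  hence "(\<integral>z. (cmod (?k z))\<^sup>2 \<partial>lborel) \<le> pi * (1 / (1 - cmod w)\<^sup>2)\<^sup>2"
    by (intro bergman_fun_bounded(2) Rep_bergman_zero_outside)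
       (use k in \<open>auto simp: bergman_fun_def\<close>)
  hence "norm (kernel_deriv 0 w) \<le> 1 / (1 - cmod w)\<^sup>2"
    unfolding norm_bergman_lborel by (intro real_le_lsqrt) (auto simp: field_simps)
  have "cmod (Rep_bergman f w) = cmod (cinner f (kernel_deriv 0 w))"
    using cinner_kernel_deriv[OF w, of f 0] by simp
  also have "\<dots> \<le> norm f * norm (kernel_deriv 0 w)" by (rule cmod_cinner_le)
  also have "\<dots> \<le> norm f * (1 / (1 - cmod w)\<^sup>2)" by (intro mult_left_mono) (fact, simp)
  finally show ?thesis by simp
qed

text \<open>The norm in the form to which Fatou's lemma applies.\<close>

lemma norm_bergman_sq_nn_integral:
  "(\<integral>\<^sup>+z. ennreal ((cmod (Rep_bergman f z))\<^sup>2) \<partial>lborel) = ennreal (pi * (norm f)\<^sup>2)"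
proof -
  have "integrable lborel (\<lambda>z. (cmod (Rep_bergman f z))\<^sup>2)"
    using Rep_bergman[of f] by (intro bergman_fun_sq_integrable) auto
  hence "(\<integral>\<^sup>+z. ennreal ((cmod (Rep_bergman f z))\<^sup>2) \<partial>lborel) =
      ennreal (\<integral>z. (cmod (Rep_bergman f z))\<^sup>2 \<partial>lborel)"
    by (intro nn_integral_eq_integral) auto
  thus ?thesis by (simp add: norm_bergman_lborel)
qed

subsection \<open>Completeness\<close>

text \<open>By the point evaluation bound, a norm-Cauchy sequence converges uniformly on smaller
  closed discs, so its pointwise limit is holomorphic. Fatou's lemma shows that this limit is square
  integrable and is also the norm limit.\<close>

instance bergman :: banach
proof
  fix X :: "nat \<Rightarrow> bergman"
  assume X: "Cauchy X"
  define x where "x = (\<lambda>n. Rep_bergman (X n))"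
  have x: "bergman_fun (x n)" for n using Rep_bergman by (auto simp: x_def)
  have pt: "cmod (x m z - x n z) \<le> norm (X m - X n) / (1 - cmod z)\<^sup>2" if "z \<in> unit_disc" for m n z
    using cmod_Rep_bergman_le[OF that, of "X m - X n"] by (simp add: x_def minus_bergman.rep_eq)
  have unif: "uniform_limit (cball 0 r) x (\<lambda>z. lim (\<lambda>n. x n z)) sequentially" if r: "0 \<le> r" "r < 1" for r
    unfolding uniformly_convergent_uniform_limit_iff[symmetric]
  proof (rule Cauchy_uniformly_convergent, rule uniformly_Cauchy_onI)
    fix e :: real assume "e > 0"
    \<comment> \<open>The factor compensates the constant \<open>1 / (1 - r)^2\<close> of the
      pointwise bound on the closed disc of radius \<open>r\<close>.\<close>
    hence "e * (1 - r)\<^sup>2 > 0" using r by simp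
    then obtain M where M: "\<And>m n. m \<ge> M \<Longrightarrow> n \<ge> M \<Longrightarrow> norm (X m - X n) < e * (1 - r)\<^sup>2"
      using CauchyD[OF X] by meson
    have "dist (x m z) (x n z) < e" if "z \<in> cball 0 r" "m \<ge> M" "n \<ge> M" for z m n
    proof -
      have z: "z \<in> unit_disc" "cmod z \<le> r" using that r by auto
      have "dist (x m z) (x n z) \<le> norm (X m - X n) / (1 - cmod z)\<^sup>2"
        using pt[OF z(1)] by (simp add: dist_norm)
      also have "\<dots> \<le> norm (X m - X n) / (1 - r)\<^sup>2"
        using z r by (intro divide_left_mono power_mono) auto
      also have "\<dots> < e" using M[OF that(2,3)] r by (simp add: divide_less_eq)
      finally show ?thesis .
    qed
    thus "\<exists>M. \<forall>z\<in>cball 0 r. \<forall>m\<ge>M. \<forall>n\<ge>M. dist (x m z) (x n z) < e" by blast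
  qed
  define G where "G = (\<lambda>z. lim (\<lambda>n. x n z))"
  have zero: "x n z = 0" if "z \<notin> unit_disc" for n z
    using that unfolding x_def by (rule Rep_bergman_zero_outside)
  have G0: "G z = 0" if "z \<notin> unit_disc" for z
    using zero[OF that] by (simp add: G_def)
  have lim: "(\<lambda>n. x n z) \<longlonglongrightarrow> G z" for z
  proof (cases "z \<in> unit_disc")
    case True
    thus ?thesis unfolding G_def using tendsto_uniform_limitI[OF unif[of "cmod z"], of z] by simp
  next
    case False
    thus ?thesis by (simp add: zero G0)
  qed
  have hol: "G holomorphic_on unit_disc"
  proof (rule holomorphic_uniform_sequence)
    show "x n holomorphic_on unit_disc" for n using x by (auto simp: bergman_fun_def)
    fix z :: complex assume z: "z \<in> unit_disc"
    \<comment> \<open>Half the distance from \<open>z\<close> to the unit circle, so that the closed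
      disc around \<open>z\<close> lies in a centred one of radius below 1.\<close>
    define d where "d = (1 - cmod z) / 2"
    have sub: "cball z d \<subseteq> cball 0 (cmod z + d)" by (simp add: cball_subset_cball_iff)
    have d: "d > 0" "cmod z + d < 1" using z by (auto simp: d_def field_simps)
    have "uniform_limit (cball z d) x G sequentially"
      unfolding G_def by (rule uniform_limit_on_subset[OF unif sub]) (use d in auto)
    moreover have "cball z d \<subseteq> unit_disc" using sub d by auto
    ultimately show "\<exists>d>0. cball z d \<subseteq> unit_disc \<and> uniform_limit (cball z d) x G sequentially"
      using d by blast
  qed auto
  have [measurable]: "x n \<in> borel_measurable borel" for n using x by (rule bergman_fun_measurable)
  have [measurable]: "G \<in> borel_measurable borel"
    by (rule borel_measurable_LIMSEQ_metric[OF _ lim]) measurable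
  \<comment> \<open>Here \<open>n\<close> is fixed and \<open>m\<close> tends to infinity. The case
    \<open>e = 1\<close> puts the limit into the space; small bounds give norm convergence.\<close>
  have fatou: "(\<integral>\<^sup>+z. ennreal ((cmod (x n z - G z))\<^sup>2) \<partial>lborel) \<le> ennreal (pi * e\<^sup>2)"
    if M: "\<And>m. m \<ge> M \<Longrightarrow> norm (X n - X m) \<le> e" for n M e
  proof -
    have "(\<integral>\<^sup>+z. ennreal ((cmod (x n z - G z))\<^sup>2) \<partial>lborel) =
        (\<integral>\<^sup>+z. liminf (\<lambda>m. ennreal ((cmod (x n z - x m z))\<^sup>2)) \<partial>lborel)"
    proof (rule nn_integral_cong)
      fix z
      have "(\<lambda>m. ennreal ((cmod (x n z - x m z))\<^sup>2)) \<longlonglongrightarrow> ennreal ((cmod (x n z - G z))\<^sup>2)"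
        by (intro tendsto_intros lim)
      thus "ennreal ((cmod (x n z - G z))\<^sup>2) = liminf (\<lambda>m. ennreal ((cmod (x n z - x m z))\<^sup>2))"
        by (intro lim_imp_Liminf[symmetric]) auto
    qed
    also have "\<dots> \<le> liminf (\<lambda>m. \<integral>\<^sup>+z. ennreal ((cmod (x n z - x m z))\<^sup>2) \<partial>lborel)"
      by (rule nn_integral_liminf) measurable
    also have "(\<lambda>m. \<integral>\<^sup>+z. ennreal ((cmod (x n z - x m z))\<^sup>2) \<partial>lborel) =
        (\<lambda>m. ennreal (pi * (norm (X n - X m))\<^sup>2))"
      using norm_bergman_sq_nn_integral[of "X n - X m" for m] by (simp add: x_def minus_bergman.rep_eq)
    also have "liminf \<dots> \<le> limsup \<dots>" by (rule Liminf_le_Limsup) simp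
    also have "\<dots> \<le> ennreal (pi * e\<^sup>2)"
    proof (rule Limsup_bounded)
      show "\<forall>\<^sub>F m in sequentially. ennreal (pi * (norm (X n - X m))\<^sup>2) \<le> ennreal (pi * e\<^sup>2)"
        using eventually_ge_at_top[of M]
        by eventually_elim (intro ennreal_leI mult_left_mono power_mono M, auto)
    qed
    finally show ?thesis .
  qed
  have diff: "bergman_fun (\<lambda>z. x n z - G z)" if "\<And>m. m \<ge> M \<Longrightarrow> norm (X n - X m) \<le> e" for n M e
  proof (rule bergman_funI)
    show "(\<lambda>z. x n z - G z) holomorphic_on unit_disc"
      using x[of n] hol by (auto simp: bergman_fun_def intro!: holomorphic_intros)
    show "integrable lborel (\<lambda>z. (cmod (x n z - G z))\<^sup>2)"
    proof (rule integrableI_bounded)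
      have "(\<integral>\<^sup>+z. ennreal ((cmod (x n z - G z))\<^sup>2) \<partial>lborel) < \<infinity>"
        using fatou[OF that] by (rule order.strict_trans1) auto
      thus "(\<integral>\<^sup>+z. ennreal (norm ((cmod (x n z - G z))\<^sup>2)) \<partial>lborel) < \<infinity>" by simp
    qed measurable
  qed (simp add: zero G0)
  obtain N where N: "\<And>m. m \<ge> N \<Longrightarrow> norm (X N - X m) \<le> 1"
    using CauchyD[OF X zero_less_one] by (meson less_imp_le order_refl)
  \<comment> \<open>\<open>G\<close> is recovered as the member \<open>x N\<close> minus the square
    integrable difference \<open>x N - G\<close>.\<close>
  have "bergman_fun (\<lambda>z. x N z + (-1) * (x N z - G z))"
    by (intro bergman_fun_add bergman_fun_cmult x diff[OF N])
  hence G: "bergman_fun G" by simp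
  define L where "L = Abs_bergman G"
  have L: "Rep_bergman L = G" unfolding L_def using G by (simp add: Abs_bergman_inverse)
  have "X \<longlonglongrightarrow> L"
  proof (rule LIMSEQ_I)
    fix e :: real assume e: "e > 0"
    obtain M where M: "\<And>m n. m \<ge> M \<Longrightarrow> n \<ge> M \<Longrightarrow> norm (X m - X n) < e / 2"
      using CauchyD[OF X, of "e / 2"] e by auto
    have "norm (X n - L) < e" if "n \<ge> M" for n
    proof -
      have "ennreal (pi * (norm (X n - L))\<^sup>2) = (\<integral>\<^sup>+z. ennreal ((cmod (x n z - G z))\<^sup>2) \<partial>lborel)"
        by (simp add: norm_bergman_sq_nn_integral[symmetric] minus_bergman.rep_eq x_def L)
      also have "\<dots> \<le> ennreal (pi * (e / 2)\<^sup>2)"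
        by (rule fatou[of M]) (use M[OF that] in \<open>auto intro: less_imp_le\<close>)
      finally have "(norm (X n - L))\<^sup>2 \<le> (e / 2)\<^sup>2"
        by (subst (asm) ennreal_le_iff) auto
      hence "norm (X n - L) \<le> e / 2" by (rule power2_le_imp_le) (use e in auto)
      thus ?thesis using e by simp
    qed
    thus "\<exists>no. \<forall>n\<ge>no. norm (X n - L) < e" by blast
  qed
  thus "convergent X" by (rule convergentI)
qed

text \<open>By Pythagoras, the squared norm of a block of the series is the corresponding block of
  the series of squared norms, so the Cauchy criterion transfers.\<close>

lemma summable_orthogonal:
  fixes x :: "nat \<Rightarrow> 'a::{real_inner, banach}"
  assumes orth: "\<And>m n. m \<noteq> n \<Longrightarrow> orthogonal (x m) (x n)"
    and summ: "summable (\<lambda>n. (norm (x n))\<^sup>2)"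
  shows "summable x"
  unfolding summable_Cauchy
proof (intro allI impI)
  fix e :: real assume e: "e > 0"
  then obtain N where N: "\<And>m n. m \<ge> N \<Longrightarrow> norm (\<Sum>k=m..<n. (norm (x k))\<^sup>2) < e\<^sup>2"
    using summ unfolding summable_Cauchy by (meson zero_less_power)
  have "norm (sum x {m..<n}) < e" if "m \<ge> N" for m n
  proof -
    have "(norm (sum x {m..<n}))\<^sup>2 = (\<Sum>k=m..<n. (norm (x k))\<^sup>2)"
      by (rule norm_sum_Pythagorean) (auto simp: pairwise_def orth)
    also have "\<dots> < e\<^sup>2" using N[OF that, of n] by simp
    finally show ?thesis by (rule power2_less_imp_less) (use e in simp)
  qed
  thus "\<exists>N. \<forall>m\<ge>N. \<forall>n. norm (sum x {m..<n}) < e" by blast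
qed

subsection \<open>Orthogonal expansions\<close>

definition orthonormal_or_zero :: "(nat \<Rightarrow> bergman) \<Rightarrow> bool"
  where "orthonormal_or_zero B \<longleftrightarrow> (\<forall>m n. cinner (B m) (B n) = (if m = n \<and> B n \<noteq> 0 then 1 else 0))"

lemma cinner_expansion_term:
  assumes "orthonormal_or_zero B"
  shows "cinner (cinner f (B k) *\<^sub>C B k) (B n) = (if k = n then cinner f (B n) else 0)"
  using assms by (auto simp: orthonormal_or_zero_def cinner_cscale_left)

lemma norm_expansion_term:
  assumes "orthonormal_or_zero B"
  shows "norm (cinner f (B k) *\<^sub>C B k) = cmod (cinner f (B k))"
proof (cases "B k = 0")
  case False
  hence "complex_of_real ((norm (B k))\<^sup>2) = 1"
    using assms by (simp only: orthonormal_or_zero_def cinner_self[symmetric]) simp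
  hence "norm (B k) = 1"
    by (simp only: of_real_eq_1_iff power2_eq_1_iff) (use norm_ge_zero[of "B k"] in linarith)
  thus ?thesis by (simp add: norm_cscale)
qed (simp add: norm_cscale)

lemma orthogonal_expansion_terms:
  assumes "orthonormal_or_zero B" "m \<noteq> n"
  shows "orthogonal (cinner f (B m) *\<^sub>C B m) (cinner f (B n) *\<^sub>C B n)"
  using assms by (simp add: orthogonal_def inner_bergman_def cinner_cscale_right cinner_expansion_term)

text \<open>In the squared distance from \<open>f\<close> to its partial sum, the inner product with
  \<open>f\<close> and the squared norm of the partial sum both equal the sum of squared
  coefficients.\<close>

lemma bessel_inequality:
  assumes B: "orthonormal_or_zero B"
  shows "(\<Sum>k<n. (cmod (cinner f (B k)))\<^sup>2) \<le> (norm f)\<^sup>2"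
proof -
  let ?x = "\<lambda>k. cinner f (B k) *\<^sub>C B k"
  have 1: "(norm (\<Sum>k<n. ?x k))\<^sup>2 = (\<Sum>k<n. (cmod (cinner f (B k)))\<^sup>2)"
    by (subst norm_sum_Pythagorean)
      (auto simp: pairwise_def orthogonal_expansion_terms[OF B] norm_expansion_term[OF B])
  have "inner f (?x k) = (cmod (cinner f (B k)))\<^sup>2" for k
  proof -
    have "cinner f (?x k) = of_real ((cmod (cinner f (B k)))\<^sup>2)"
      by (simp only: cinner_cscale_right of_real_power complex_norm_square[symmetric] mult.commute[of "cnj _"])
    thus ?thesis by (simp only: inner_bergman_def Re_complex_of_real)
  qed
  hence 2: "inner f (\<Sum>k<n. ?x k) = (\<Sum>k<n. (cmod (cinner f (B k)))\<^sup>2)"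
    by (simp add: inner_sum_right)
  have "0 \<le> (norm (f - (\<Sum>k<n. ?x k)))\<^sup>2" by simp
  also have "\<dots> = (norm f)\<^sup>2 - 2 * inner f (\<Sum>k<n. ?x k) + (norm (\<Sum>k<n. ?x k))\<^sup>2"
    by (simp add: power2_norm_eq_inner inner_diff_left inner_diff_right inner_commute)
  finally show ?thesis unfolding 1 2 by simp
qed

text \<open>Bessel's inequality bounds the sums of squared norms of the orthogonal terms;
  completeness then gives convergence.\<close>

lemma summable_expansion:
  assumes B: "orthonormal_or_zero B"
  shows "summable (\<lambda>k. cinner f (B k) *\<^sub>C B k)"
proof (rule summable_orthogonal)
  show "summable (\<lambda>k. (norm (cinner f (B k) *\<^sub>C B k))\<^sup>2)"
    unfolding norm_expansion_term[OF B]
    by (rule summableI_nonneg_bounded[OF _ bessel_inequality[OF B]]) simp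
qed (rule orthogonal_expansion_terms[OF B])

text \<open>Continuity of the pairing lets it be evaluated termwise on the series, where only the
  term \<open>k = n\<close> survives.\<close>

lemma cinner_expansion_residual:
  assumes B: "orthonormal_or_zero B"
  shows "cinner (f - (\<Sum>k. cinner f (B k) *\<^sub>C B k)) (B n) = 0"
proof -
  have "(\<lambda>k. cinner (cinner f (B k) *\<^sub>C B k) (B n)) sums cinner (\<Sum>k. cinner f (B k) *\<^sub>C B k) (B n)"
    by (intro bounded_linear.sums[OF bounded_linear_cinner_left] summable_sums summable_expansion B)
  moreover have "(\<lambda>k. cinner (cinner f (B k) *\<^sub>C B k) (B n)) sums cinner f (B n)"
    unfolding cinner_expansion_term[OF B] using sums_single[of n "\<lambda>_. cinner f (B n)"]
    by (simp only: eq_commute[of n])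
  ultimately have "cinner (\<Sum>k. cinner f (B k) *\<^sub>C B k) (B n) = cinner f (B n)"
    by (rule sums_unique2)
  thus ?thesis by (simp add: cinner_diff_left)
qed

lemma subspace_closure_bergman:
  assumes S: "bergman.subspace S"
  shows "bergman.subspace (closure S)"
proof (rule bergman.subspaceI)
  show "0 \<in> closure S"
    using bergman.subspace_0[OF S] closure_subset by blast
next
  fix f g assume "f \<in> closure S" "g \<in> closure S"
  then obtain F G where "\<And>n. F n \<in> S" "F \<longlonglongrightarrow> f" "\<And>n. G n \<in> S" "G \<longlonglongrightarrow> g"
    unfolding closure_sequential by blast
  thus "f + g \<in> closure S"
    unfolding closure_sequential
    by (intro exI[of _ "\<lambda>n. F n + G n"]) (auto intro: tendsto_add bergman.subspace_add[OF S])
next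
  fix c f assume "f \<in> closure S"
  then obtain F where "\<And>n. F n \<in> S" "F \<longlonglongrightarrow> f"
    unfolding closure_sequential by blast
  thus "c *\<^sub>C f \<in> closure S"
    unfolding closure_sequential
    by (intro exI[of _ "\<lambda>n. c *\<^sub>C F n"])
      (auto intro: bounded_linear.tendsto[OF bounded_linear_cscale] bergman.subspace_scale[OF S])
qed

lemma cinner_closure_span_eq_0:
  assumes g: "\<And>b. b \<in> S \<Longrightarrow> cinner b g = 0" and f: "f \<in> closure (bergman.span S)"
  shows "cinner f g = 0"
proof -
  have "cinner b g = 0" if "b \<in> bergman.span S" for b
    using that by (induction rule: bergman.span_induct_alt) (auto simp: cinner_add_left cinner_cscale_left g)
  moreover obtain F where F: "\<And>n. F n \<in> bergman.span S" "F \<longlonglongrightarrow> f"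
    using f unfolding closure_sequential by blast
  ultimately have "(\<lambda>n. cinner (F n) g) = (\<lambda>_. 0)" by auto
  moreover have "(\<lambda>n. cinner (F n) g) \<longlonglongrightarrow> cinner f g"
    by (rule bounded_linear.tendsto[OF bounded_linear_cinner_left F(2)])
  ultimately show ?thesis by (simp add: LIMSEQ_const_iff)
qed

text \<open>The expansion is the projection onto the closed span and the residual is its orthogonal
  part. A vector in both summands is orthogonal to itself, hence zero.\<close>

lemma orthogonal_direct_sum_closure_span:
  assumes B: "orthonormal_or_zero B"
  shows "orthogonal_direct_sum UNIV (closure (bergman.span (range B))) {f. \<forall>n. cinner f (B n) = 0}"
    (is "orthogonal_direct_sum UNIV ?S ?T")
  unfolding orthogonal_direct_sum_def
proof (intro conjI ballI)
  show subS: "bergman.subspace ?S"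
    by (intro subspace_closure_bergman bergman.subspace_span)
  show subT: "bergman.subspace ?T"
    by (rule bergman.subspaceI) (auto simp: cinner_add_left cinner_cscale_left)
  show orth: "cinner f g = 0" if "f \<in> ?S" "g \<in> ?T" for f g
    using that by (intro cinner_closure_span_eq_0[OF _ that(1)])
      (auto simp: cinner_commute[of "B n" for n])
  show "?S \<inter> ?T = {0}"
  proof
    show "?S \<inter> ?T \<subseteq> {0}"
    proof
      fix f assume f: "f \<in> ?S \<inter> ?T"
      have "cinner f f = 0" using f by (intro orth) blast+
      thus "f \<in> {0}" by (simp add: cinner_self)
    qed
    show "{0} \<subseteq> ?S \<inter> ?T"
      using bergman.subspace_0[OF subS] bergman.subspace_0[OF subT] by blast
  qed
  have "\<exists>s t. f = s + t \<and> s \<in> ?S \<and> t \<in> ?T" for f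
  proof (intro exI conjI)
    let ?s = "\<Sum>k. cinner f (B k) *\<^sub>C B k"
    show "f = ?s + (f - ?s)" by simp
    show "f - ?s \<in> ?T" using cinner_expansion_residual[OF B] by blast
    have "(\<lambda>n. \<Sum>k<n. cinner f (B k) *\<^sub>C B k) \<longlonglongrightarrow> ?s"
      by (intro summable_LIMSEQ summable_expansion B)
    moreover have "(\<Sum>k<n. cinner f (B k) *\<^sub>C B k) \<in> bergman.span (range B)" for n
      by (intro bergman.span_sum bergman.span_scale bergman.span_base) auto
    ultimately show "?s \<in> ?S"
      unfolding closure_sequential
      by (intro exI[of _ "\<lambda>n. \<Sum>k<n. cinner f (B k) *\<^sub>C B k"]) simp
  qed
  thus "UNIV = {f + g |f g. f \<in> ?S \<and> g \<in> ?T}" by blast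
qed

subsection \<open>Gram--Schmidt and the vanishing conditions\<close>

lemma cinner_gram_schmidt_self:
  "cinner (gram_schmidt v n) (gram_schmidt v n) = (if gram_schmidt v n = 0 then 0 else 1)"
proof -
  define u where "u = v n - (\<Sum>k<n. cinner (v n) (gram_schmidt v k) *\<^sub>C gram_schmidt v k)"
  have B: "gram_schmidt v n = u /\<^sub>R norm u"
    by (subst gram_schmidt.simps) (simp add: u_def Let_def)
  show ?thesis
    by (cases "u = 0") (simp_all add: B cinner_self)
qed

text \<open>By induction the earlier vectors are mutually orthogonal, so pairing the subtracted sum
  with \<open>gram_schmidt v k\<close> gives exactly the pairing of \<open>v n\<close> with
  it.\<close>

lemma gram_schmidt_orthogonal:
  "k < n \<Longrightarrow> cinner (gram_schmidt v n) (gram_schmidt v k) = 0"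
proof (induction n arbitrary: k rule: less_induct)
  case (less n)
  let ?B = "gram_schmidt v"
  define u where "u = v n - (\<Sum>l<n. cinner (v n) (?B l) *\<^sub>C ?B l)"
  have B: "?B n = u /\<^sub>R norm u"
    by (subst gram_schmidt.simps) (simp add: u_def Let_def)
  have orth: "cinner (?B l) (?B k) = 0" if "l < n" "l \<noteq> k" for l
  proof (cases "l < k")
    case True
    from less.IH[OF less.prems True] show ?thesis by (simp add: cinner_commute[of "?B l"])
  next
    case False
    with that less.IH[of l k] show ?thesis by simp
  qed
  \<comment> \<open>If \<open>?B k\<close> is zero, the term \<open>l = k\<close> vanishes on both
    sides; otherwise \<open>?B k\<close> has norm 1.\<close>
  have "(\<Sum>l<n. cinner (cinner (v n) (?B l) *\<^sub>C ?B l) (?B k)) =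
      (\<Sum>l<n. if l = k then cinner (v n) (?B k) else 0)"
    by (intro sum.cong) (auto simp: cinner_cscale_left orth cinner_gram_schmidt_self)
  also have "\<dots> = cinner (v n) (?B k)" using less.prems by simp
  finally have "cinner u (?B k) = 0"
    by (simp add: u_def cinner_diff_left cinner_sum_left)
  thus ?case by (simp add: B scaleR_eq_cscale cinner_cscale_left)
qed

lemma orthonormal_or_zero_gram_schmidt: "orthonormal_or_zero (gram_schmidt v)"
  unfolding orthonormal_or_zero_def
proof (intro allI)
  fix m n :: nat
  consider "m = n" | "n < m" | "m < n" by linarith
  thus "cinner (gram_schmidt v m) (gram_schmidt v n) = (if m = n \<and> gram_schmidt v n \<noteq> 0 then 1 else 0)"
  proof cases
    case 3
    thus ?thesis using gram_schmidt_orthogonal[OF 3, of v]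
      by (simp add: cinner_commute[of "gram_schmidt v m"])
  qed (simp_all add: cinner_gram_schmidt_self gram_schmidt_orthogonal)
qed

text \<open>If \<open>f\<close> is orthogonal to the earlier Gram-Schmidt vectors, the projections
  subtracted from \<open>v n\<close> do not change its pairing with \<open>f\<close>. One direction
  uses this along a strong induction, the other directly.\<close>

lemma cinner_gram_schmidt_eq_0_iff:
  "(\<forall>n. cinner f (gram_schmidt v n) = 0) \<longleftrightarrow> (\<forall>n. cinner f (v n) = 0)"
proof -
  let ?B = "gram_schmidt v"
  define u where "u = (\<lambda>n. v n - (\<Sum>k<n. cinner (v n) (?B k) *\<^sub>C ?B k))"
  have B: "?B n = u n /\<^sub>R norm (u n)" for n
    by (subst gram_schmidt.simps) (simp add: u_def Let_def)
  \<comment> \<open>Normalisation preserves vanishing also when \<open>u n = 0\<close>, since then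
    both vectors are zero.\<close>
  have iff: "cinner f (?B n) = 0 \<longleftrightarrow> cinner f (u n) = 0" for n
    by (auto simp: B scaleR_eq_cscale cinner_cscale_right)
  have u: "cinner f (u n) = cinner f (v n)" if "\<And>k. k < n \<Longrightarrow> cinner f (?B k) = 0" for n
  proof -
    have "cinner (u n) f = cinner (v n) f"
      using that by (simp add: u_def cinner_diff_left cinner_sum_left cinner_cscale_left
        cinner_commute[of "?B k" f for k])
    thus ?thesis by (simp add: cinner_commute[of f])
  qed
  show ?thesis
  proof
    assume "\<forall>n. cinner f (v n) = 0"
    hence "cinner f (?B n) = 0" for n
      by (induction n rule: less_induct) (simp add: iff u)
    thus "\<forall>n. cinner f (?B n) = 0" by blast
  qed (use iff u in metis)
qed

text \<open>The function counting the elements of \<open>S\<close> below \<open>n\<close> starts at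
  0 and grows in steps of at most 1; where it passes from \<open>j\<close> to \<open>j + 1\<close>
  lies an element of \<open>S\<close> with exactly \<open>j\<close> predecessors in
  \<open>S\<close>.\<close>

lemma ex_nat_with_rank:
  fixes S :: "nat set"
  assumes "infinite S \<or> j < card S"
  shows "\<exists>n\<in>S. card {m. m < n \<and> m \<in> S} = j"
proof -
  define r where "r = (\<lambda>n. card {m. m < n \<and> m \<in> S})"
  have r_Suc: "r (Suc n) = (if n \<in> S then Suc (r n) else r n)" for n
  proof -
    have "{m. m < Suc n \<and> m \<in> S} = (if n \<in> S then insert n {m. m < n \<and> m \<in> S} else {m. m < n \<and> m \<in> S})"
      by (auto simp: less_Suc_eq)
    thus ?thesis by (simp add: r_def)
  qed
  \<comment> \<open>A finite subset of size \<open>j + 1\<close> treats infinite and large finite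
    \<open>S\<close> alike, and shows that the count does reach \<open>j + 1\<close>.\<close>
  obtain T where T: "T \<subseteq> S" "finite T" "card T = Suc j"
    using assms by (metis Suc_leI infinite_arbitrarily_large obtain_subset_with_card_n)
  have "T \<subseteq> {m. m < Suc (Max T) \<and> m \<in> S}"
    using T by (auto simp: less_Suc_eq_le)
  hence "r (Suc (Max T)) \<ge> Suc j"
    unfolding r_def T(3)[symmetric] by (intro card_mono) auto
  define N where "N = (LEAST n. r n \<ge> Suc j)"
  have N: "r N \<ge> Suc j" unfolding N_def by (rule LeastI) fact
  then obtain n where n: "N = Suc n" by (cases N) (auto simp: r_def)
  have "\<not> r n \<ge> Suc j" using not_less_Least[of n "\<lambda>n. r n \<ge> Suc j"] n by (simp add: N_def)
  hence "n \<in> S" "r n = j" using N r_Suc[of n] n by (auto split: if_splits)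
  thus ?thesis by (auto simp: r_def)
qed

text \<open>By the reproducing property, the \<open>n\<close>-th kernel tests at \<open>a n\<close>
  the derivative whose order is the number of earlier occurrences of that value. Over all
  occurrences of \<open>c\<close>, these orders run through exactly those below the multiplicity, or
  through all of them if it is infinite.\<close>

lemma vanishing_space_eq:
  assumes a: "\<And>n. a n \<in> unit_disc"
  shows "vanishing_space a = {f. \<forall>n. cinner f (gen_kernel a n) = 0}"
proof (intro set_eqI iffI)
  fix f assume f: "f \<in> vanishing_space a"
  have "cinner f (gen_kernel a n) = 0" for n
  proof -
    \<comment> \<open>The inclusion is strict because \<open>n\<close> belongs only to the
      right-hand set.\<close>
    have "{m. m < n \<and> a m = a n} \<subset> {m. a m = a n}" by auto
    hence "infinite {m. a m = a n} \<or> card {m. m < n \<and> a m = a n} < card {m. a m = a n}"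
      by (meson psubset_card_mono)
    thus ?thesis
      using f by (simp add: gen_kernel_def cinner_kernel_deriv[OF a] vanishing_space_def)
  qed
  thus "f \<in> {f. \<forall>n. cinner f (gen_kernel a n) = 0}" by blast
next
  fix f assume f: "f \<in> {f. \<forall>n. cinner f (gen_kernel a n) = 0}"
  have "(deriv ^^ j) (Rep_bergman f) c = 0"
    if "infinite {n. a n = c} \<or> j < card {n. a n = c}" for c j
  proof -
    obtain n where "a n = c" "card {m. m < n \<and> a m = c} = j"
      using ex_nat_with_rank[of "{n. a n = c}" j] \<open>infinite _ \<or> _\<close> by auto
    moreover from f have "cinner f (gen_kernel a n) = 0" by blast
    ultimately show ?thesis
      using cinner_kernel_deriv[OF a, of f j n] by (simp add: gen_kernel_def)
  qed
  thus "f \<in> vanishing_space a" by (simp add: vanishing_space_def)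
qed

theorem theorem5p1:
  fixes a :: "nat \<Rightarrow> complex" and B :: "nat \<Rightarrow> bergman"
  assumes a: "\<And>n. a n \<in> unit_disc"
    and B: "B = gram_schmidt (gen_kernel a)"
  shows "(\<forall>f. summable (\<lambda>k. cinner f (B k) *\<^sub>C B k) \<and>
            f - (\<Sum>k. cinner f (B k) *\<^sub>C B k) \<in> vanishing_space a) \<and>
         orthogonal_direct_sum UNIV (closure (bergman.span (range B))) (vanishing_space a)"
proof -
  \<comment> \<open>Once the vanishing space is the orthogonal complement of the \<open>B n\<close>,
    both claims are instances of the general facts on orthonormal expansions.\<close>
  have V: "vanishing_space a = {f. \<forall>n. cinner f (B n) = 0}"
    unfolding vanishing_space_eq[OF a] B cinner_gram_schmidt_eq_0_iff ..
  have "orthonormal_or_zero B"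
    unfolding B by (rule orthonormal_or_zero_gram_schmidt)
  thus ?thesis
    unfolding V
    by (simp add: summable_expansion cinner_expansion_residual orthogonal_direct_sum_closure_span)
qed

end
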